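(* Let $\mathcal{A}$ be a semi-abelian category satisfying the Smith is Huq condition (SH), and let $\xi^M_N\colon M\flat N\to N$ and $\xi^N_M\colon N\flat M\to M$ be compatible internal actions in $\mathcal{A}$, with Peiffer product $q\colon M+N\to M\bowtie N$, and put $l_M=q\circ i_M$, $l_N=q\circ i_N$. Let $\xi^{M\bowtie N}_M\colon(M\bowtie N)\flat M\to M$ and $\xi^{M\bowtie N}_N\colon(M\bowtie N)\flat N\to N$ be the unique morphisms such that $\xi^{M\bowtie N}_M\circ(q\flat 1_M)=\xi^{M+N}_M$ and $\xi^{M\bowtie N}_N\circ(q\flat 1_N)=\xi^{M+N}_N$. Then: 1. $\xi^{M\bowtie N}_M$ and $\xi^{M\bowtie N}_N$ are internal actions. 2. $(l_M\colon M\to M\bowtie N,\ \xi^{M\bowtie N}_M)$ and $(l_N\colon N\to M\bowtie N,\ \xi^{M\bowtie N}_N)$ are internal crossed modules. 3. The actions induced by these crossed modules are the given ones: $\xi^{M\bowtie N}_N\circ(l_M\flat 1_N)=\xi^M_N$ and $\xi^{M\bowtie N}_M\circ(l_N\flat 1_M)=\xi^N_M$.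
   Context: A semi-abelian category is a pointed, Barr exact, Bourn protomodular category with binary coproducts. (SH): two internal equivalence relations on the same object centralise each other in the Smith–Pedicchio sense as soon as their normalisations (the corresponding normal subobjects) commute in the sense of Huq. Notation: $+$ is the coproduct (with $A+B$ and $B+A$ identified), $i_A\colon A\to A+B$ and $i_B\colon B\to A+B$ are the inclusions, $[f,g]\colon A+B\to C$ is the morphism induced by $f\colon A\to C$, $g\colon B\to C$. The functor $\flat$: $k_{A,B}\colon A\flat B\to A+B$ is the kernel of $[1_A,0]\colon A+B\to A$; for $f\colon A\to A'$, $g\colon B\to B'$, $f\flat g$ is the restriction of $f+g$ to kernels. For fixed $A$, $A\flat(-)$ is a monad with unit $\eta^A_B\colon B\to A\flat B$ determined by $k_{A,B}\circ\eta^A_B=i_B$ and multiplication $\mu^A_B\colon A\flat(A\flat B)\to A\flat B$ determined by $k_{A,B}\circ\mu^A_B=[i_A,k_{A,B}]\circ k_{A,A\flat B}$. An internal action of $A$ on $X$ is a morphism $\xi\colon A\flat X\to X$ making $X$ an algebra for this monad. The conjugation action is $\chi_A=[1_A,1_A]\circ k_{A,A}\colon A\flat A\to A$. Internal crossed module (under (SH)): a pair $(\partial\colon X\to A,\xi)$ with $\xi\colon A\flat X\to X$ an internal action such that $\xi\circ(\partial\flat 1_X)=\chi_X$ and $\partial\circ\xi=\chi_A\circ(1_A\flat\partial)$. Cosmash products: $h_{A,B}\colon A\diamond B\to A+B$ is the kernel of the canonical morphism $A+B\to A\times B$; it factors as $h_{A,B}=k_{A,B}\circ i_{A,B}$ with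 $i_{A,B}\colon A\diamond B\to A\flat B$. $h_{A,B,C}\colon A\diamond B\diamond C\to A+B+C$ is the kernel of the morphism $A+B+C\to(A+B)\times(A+C)\times(B+C)$ with components $[i_A,i_B,0]$, $[i_A,0,i_C]$, $[0,i_B,i_C]$. The morphism $j_{A,B,C}\colon A\diamond B\diamond C\to(A+B)\flat C$ is the unique one with $k_{A+B,C}\circ j_{A,B,C}=h_{A,B,C}$. The folding morphism $S^{N,M}_{1,2}\colon M\diamond N\diamond M\to N\diamond M$ is the unique one such that $h_{N,M}\circ S^{N,M}_{1,2}$ equals $h_{M,N,M}$ followed by the morphism $M+N+M\to M+N$ which folds the two copies of $M$ by the codiagonal and is the identity on $N$. Similarly $S^{M,N}_{1,2}\colon M\diamond N\diamond N\to M\diamond N$ is induced by folding the two copies of $N$. Compatibility: internal actions $\xi^M_N\colon M\flat N\to N$ and $\xi^N_M\colon N\flat M\to M$ are compatible if there exist internal actions $\xi^{M+N}_M\colon(M+N)\flat M\to M$ and $\xi^{M+N}_N\colon(M+N)\flat N\to N$ (these are then uniquely determined) such that: (CA.0) $\xi^{M+N}_M\circ(i_N\flat 1_M)=\xi^N_M$, $\ \xi^{M+N}_M\circ(i_M\flat 1_M)=\chi_M$, $\ \xi^{M+N}_M\circ j_{M,N,M}=\xi^N_M\circ i_{N,M}\circ S^{N,M}_{1,2}$, and $\xi^{M+N}_N\circ(i_M\flat 1_N)=\xi^M_N$, $\ \xi^{M+N}_N\circ(i_N\flat 1_N)=\chi_N$, $\ \xi^{M+N}_N\circ j_{M,N,N}=\xi^M_N\circ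 i_{M,N}\circ S^{M,N}_{1,2}$; (CA.M) $\xi^{M+N}_M\circ\big((\xi^N_M+\xi^M_N)\flat 1_M\big)=\xi^{M+N}_M\circ\big([k_{N,M},k_{M,N}]\flat 1_M\big)$ as morphisms $((N\flat M)+(M\flat N))\flat M\to M$; (CA.N) $\xi^{M+N}_N\circ\big((\xi^N_M+\xi^M_N)\flat 1_N\big)=\xi^{M+N}_N\circ\big([k_{N,M},k_{M,N}]\flat 1_N\big)$ as morphisms $((N\flat M)+(M\flat N))\flat N\to N$. Peiffer product: $q\colon M+N\to M\bowtie N$ is the coequaliser of the two morphisms $[k_{N,M},k_{M,N}]$ and $\xi^N_M+\xi^M_N$ from $(N\flat M)+(M\flat N)$ to $M+N$. These two morphisms form a reflexive graph with common section $\eta^N_M+\eta^M_N$, and each functor $(-)\flat X$ preserves coequalisers of reflexive graphs, so that $q\flat 1_M$ and $q\flat 1_N$ are again coequalisers; by (CA.M) and (CA.N) the morphisms $\xi^{M\bowtie N}_M$ and $\xi^{M\bowtie N}_N$ of the claim therefore exist and are unique. *)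

theory Defs
  imports Main
begin

section \<open>Categories, limits and colimits\<close>

record ('o, 'm) category =
  obj :: "'o set"
  arr :: "'m set"
  Dom :: "'m \<Rightarrow> 'o"
  Cod :: "'m \<Rightarrow> 'o"
  ide :: "'o \<Rightarrow> 'm"
  cmp :: "'m \<Rightarrow> 'm \<Rightarrow> 'm"  (infixl "\<cdot>\<index>" 75)

definition hom :: "('o, 'm, 'z) category_scheme \<Rightarrow> 'o \<Rightarrow> 'o \<Rightarrow> 'm set" where
  "hom C A B = {f \<in> arr C. Dom C f = A \<and> Cod C f = B}"

locale category =
  fixes C :: "('o, 'm, 'z) category_scheme" (structure)
  assumes Dom_obj: "f \<in> arr C \<Longrightarrow> Dom C f \<in> obj C"
    and Cod_obj: "f \<in> arr C \<Longrightarrow> Cod C f \<in> obj C"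
    and ide_hom: "A \<in> obj C \<Longrightarrow> ide C A \<in> hom C A A"
    and cmp_hom: "\<lbrakk>f \<in> hom C A B; g \<in> hom C B D\<rbrakk> \<Longrightarrow> g \<cdot> f \<in> hom C A D"
    and cmp_ide: "f \<in> hom C A B \<Longrightarrow> f \<cdot> ide C A = f"
    and ide_cmp: "f \<in> hom C A B \<Longrightarrow> ide C B \<cdot> f = f"
    and cmp_assoc:
      "\<lbrakk>f \<in> hom C A B; g \<in> hom C B D; h \<in> hom C D E\<rbrakk> \<Longrightarrow> (h \<cdot> g) \<cdot> f = h \<cdot> (g \<cdot> f)"

definition is_iso :: "('o, 'm, 'z) category_scheme \<Rightarrow> 'm \<Rightarrow> bool" where
  "is_iso C f \<longleftrightarrow> f \<in> arr C \<and>
     (\<exists>g \<in> hom C (Cod C f) (Dom C f).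
        g \<cdot>\<^bsub>C\<^esub> f = ide C (Dom C f) \<and> f \<cdot>\<^bsub>C\<^esub> g = ide C (Cod C f))"

definition is_terminal :: "('o, 'm, 'z) category_scheme \<Rightarrow> 'o \<Rightarrow> bool" where
  "is_terminal C T \<longleftrightarrow> T \<in> obj C \<and> (\<forall>A \<in> obj C. \<exists>!f. f \<in> hom C A T)"

definition is_initial :: "('o, 'm, 'z) category_scheme \<Rightarrow> 'o \<Rightarrow> bool" where
  "is_initial C I \<longleftrightarrow> I \<in> obj C \<and> (\<forall>A \<in> obj C. \<exists>!f. f \<in> hom C I A)"

definition is_zero_object :: "('o, 'm, 'z) category_scheme \<Rightarrow> 'o \<Rightarrow> bool" where
  "is_zero_object C Z \<longleftrightarrow> is_initial C Z \<and> is_terminal C Z"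

definition zero_arr :: "('o, 'm, 'z) category_scheme \<Rightarrow> 'o \<Rightarrow> 'o \<Rightarrow> 'm" where
  "zero_arr C A B =
     (THE f. \<exists>Z. is_zero_object C Z \<and> (\<exists>a \<in> hom C A Z. \<exists>b \<in> hom C Z B. f = b \<cdot>\<^bsub>C\<^esub> a))"

definition is_product ::
    "('o, 'm, 'z) category_scheme \<Rightarrow> 'o \<Rightarrow> 'm \<Rightarrow> 'm \<Rightarrow> 'o \<Rightarrow> 'o \<Rightarrow> bool" where
  "is_product C P p1 p2 A B \<longleftrightarrow>
     p1 \<in> hom C P A \<and> p2 \<in> hom C P B \<and>
     (\<forall>T \<in> obj C. \<forall>f \<in> hom C T A. \<forall>g \<in> hom C T B.
        \<exists>!h. h \<in> hom C T P \<and> p1 \<cdot>\<^bsub>C\<^esub> h = f \<and> p2 \<cdot>\<^bsub>C\<^esub> h = g)"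

definition is_coproduct ::
    "('o, 'm, 'z) category_scheme \<Rightarrow> 'o \<Rightarrow> 'm \<Rightarrow> 'm \<Rightarrow> 'o \<Rightarrow> 'o \<Rightarrow> bool" where
  "is_coproduct C S i1 i2 A B \<longleftrightarrow>
     i1 \<in> hom C A S \<and> i2 \<in> hom C B S \<and>
     (\<forall>T \<in> obj C. \<forall>f \<in> hom C A T. \<forall>g \<in> hom C B T.
        \<exists>!h. h \<in> hom C S T \<and> h \<cdot>\<^bsub>C\<^esub> i1 = f \<and> h \<cdot>\<^bsub>C\<^esub> i2 = g)"

definition is_pullback ::
    "('o, 'm, 'z) category_scheme \<Rightarrow> 'o \<Rightarrow> 'm \<Rightarrow> 'm \<Rightarrow> 'm \<Rightarrow> 'm \<Rightarrow> bool" where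
  "is_pullback C P p1 p2 f g \<longleftrightarrow>
     f \<in> arr C \<and> g \<in> arr C \<and> Cod C f = Cod C g \<and>
     p1 \<in> hom C P (Dom C f) \<and> p2 \<in> hom C P (Dom C g) \<and> f \<cdot>\<^bsub>C\<^esub> p1 = g \<cdot>\<^bsub>C\<^esub> p2 \<and>
     (\<forall>T \<in> obj C. \<forall>a \<in> hom C T (Dom C f). \<forall>b \<in> hom C T (Dom C g).
        f \<cdot>\<^bsub>C\<^esub> a = g \<cdot>\<^bsub>C\<^esub> b \<longrightarrow>
        (\<exists>!h. h \<in> hom C T P \<and> p1 \<cdot>\<^bsub>C\<^esub> h = a \<and> p2 \<cdot>\<^bsub>C\<^esub> h = b))"

definition is_coequalizer :: "('o, 'm, 'z) category_scheme \<Rightarrow> 'm \<Rightarrow> 'm \<Rightarrow> 'm \<Rightarrow> bool" where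
  "is_coequalizer C q f g \<longleftrightarrow>
     f \<in> arr C \<and> g \<in> hom C (Dom C f) (Cod C f) \<and>
     q \<in> arr C \<and> Dom C q = Cod C f \<and> q \<cdot>\<^bsub>C\<^esub> f = q \<cdot>\<^bsub>C\<^esub> g \<and>
     (\<forall>T \<in> obj C. \<forall>t \<in> hom C (Cod C f) T. t \<cdot>\<^bsub>C\<^esub> f = t \<cdot>\<^bsub>C\<^esub> g \<longrightarrow>
        (\<exists>!h. h \<in> hom C (Cod C q) T \<and> h \<cdot>\<^bsub>C\<^esub> q = t))"

definition is_kernel :: "('o, 'm, 'z) category_scheme \<Rightarrow> 'm \<Rightarrow> 'm \<Rightarrow> bool" where
  "is_kernel C k f \<longleftrightarrow>
     f \<in> arr C \<and> k \<in> arr C \<and> Cod C k = Dom C f \<and>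
     f \<cdot>\<^bsub>C\<^esub> k = zero_arr C (Dom C k) (Cod C f) \<and>
     (\<forall>T \<in> obj C. \<forall>t \<in> hom C T (Dom C f). f \<cdot>\<^bsub>C\<^esub> t = zero_arr C T (Cod C f) \<longrightarrow>
        (\<exists>!h. h \<in> hom C T (Dom C k) \<and> k \<cdot>\<^bsub>C\<^esub> h = t))"

definition finitely_complete :: "('o, 'm, 'z) category_scheme \<Rightarrow> bool" where
  "finitely_complete C \<longleftrightarrow>
     (\<exists>T. is_terminal C T) \<and>
     (\<forall>f \<in> arr C. \<forall>g \<in> arr C. Cod C f = Cod C g \<longrightarrow> (\<exists>P p1 p2. is_pullback C P p1 p2 f g))"


section \<open>Semi-abelian categories\<close>

definition regular_epi :: "('o, 'm, 'z) category_scheme \<Rightarrow> 'm \<Rightarrow> bool" where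
  "regular_epi C e \<longleftrightarrow> (\<exists>f g. is_coequalizer C e f g)"

definition is_regular_category :: "('o, 'm, 'z) category_scheme \<Rightarrow> bool" where
  "is_regular_category C \<longleftrightarrow>
     finitely_complete C \<and>
     (\<forall>f P p1 p2. is_pullback C P p1 p2 f f \<longrightarrow> (\<exists>q. is_coequalizer C q p1 p2)) \<and>
     (\<forall>f g P p1 p2. is_pullback C P p1 p2 f g \<and> regular_epi C f \<longrightarrow> regular_epi C p2)"

definition internal_equivalence_relation ::
    "('o, 'm, 'z) category_scheme \<Rightarrow> 'o \<Rightarrow> 'o \<Rightarrow> 'm \<Rightarrow> 'm \<Rightarrow> bool" where
  "internal_equivalence_relation C X R r1 r2 \<longleftrightarrow>
     r1 \<in> hom C R X \<and> r2 \<in> hom C R X \<and>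
     (\<forall>T \<in> obj C. \<forall>f \<in> hom C T R. \<forall>g \<in> hom C T R.
        r1 \<cdot>\<^bsub>C\<^esub> f = r1 \<cdot>\<^bsub>C\<^esub> g \<and> r2 \<cdot>\<^bsub>C\<^esub> f = r2 \<cdot>\<^bsub>C\<^esub> g \<longrightarrow> f = g) \<and>
     (\<exists>d \<in> hom C X R. r1 \<cdot>\<^bsub>C\<^esub> d = ide C X \<and> r2 \<cdot>\<^bsub>C\<^esub> d = ide C X) \<and>
     (\<exists>s \<in> hom C R R. r1 \<cdot>\<^bsub>C\<^esub> s = r2 \<and> r2 \<cdot>\<^bsub>C\<^esub> s = r1) \<and>
     (\<forall>P p1 p2. is_pullback C P p1 p2 r2 r1 \<longrightarrow>
        (\<exists>t \<in> hom C P R. r1 \<cdot>\<^bsub>C\<^esub> t = r1 \<cdot>\<^bsub>C\<^esub> p1 \<and> r2 \<cdot>\<^bsub>C\<^esub> t = r2 \<cdot>\<^bsub>C\<^esub> p2))"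

definition is_barr_exact :: "('o, 'm, 'z) category_scheme \<Rightarrow> bool" where
  "is_barr_exact C \<longleftrightarrow>
     is_regular_category C \<and>
     (\<forall>X R r1 r2. internal_equivalence_relation C X R r1 r2 \<longrightarrow>
        (\<exists>f. is_pullback C R r1 r2 f f))"

definition is_point :: "('o, 'm, 'z) category_scheme \<Rightarrow> 'o \<Rightarrow> 'o \<Rightarrow> 'm \<Rightarrow> 'm \<Rightarrow> bool" where
  "is_point C B X p s \<longleftrightarrow> p \<in> hom C X B \<and> s \<in> hom C B X \<and> p \<cdot>\<^bsub>C\<^esub> s = ide C B"

text \<open>Bourn protomodularity: for every \<open>v : E \<rightarrow> B\<close> the pullback functor \<open>v\<^sup>*\<close> from the category of
  points over \<open>B\<close> to the category of points over \<open>E\<close> reflects isomorphisms. Here \<open>f\<close> is a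
  morphism of points over \<open>B\<close> and \<open>g\<close> is its image under \<open>v\<^sup>*\<close>; the sections of the pulled
  back points are determined by the pullbacks, and \<open>g\<close> automatically preserves them.\<close>

definition is_protomodular :: "('o, 'm, 'z) category_scheme \<Rightarrow> bool" where
  "is_protomodular C \<longleftrightarrow>
     (\<forall>E B v X p s X' p' s' f P a b P' a' b' g.
        v \<in> hom C E B \<and> is_point C B X p s \<and> is_point C B X' p' s' \<and>
        f \<in> hom C X X' \<and> p' \<cdot>\<^bsub>C\<^esub> f = p \<and> f \<cdot>\<^bsub>C\<^esub> s = s' \<and>
        is_pullback C P a b v p \<and> is_pullback C P' a' b' v p' \<and>
        g \<in> hom C P P' \<and> a' \<cdot>\<^bsub>C\<^esub> g = a \<and> b' \<cdot>\<^bsub>C\<^esub> g = f \<cdot>\<^bsub>C\<^esub> b \<and>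
        is_iso C g \<longrightarrow> is_iso C f)"

locale semi_abelian_category = category +
  assumes pointed: "\<exists>Z. is_zero_object C Z"
    and barr_exact: "is_barr_exact C"
    and protomodular: "is_protomodular C"
    and binary_coproducts:
      "\<lbrakk>A \<in> obj C; B \<in> obj C\<rbrakk> \<Longrightarrow> \<exists>S i1 i2. is_coproduct C S i1 i2 A B"


section \<open>The Smith is Huq condition\<close>

text \<open>The morphisms \<open>m : K \<rightarrow> X\<close> and \<open>n : L \<rightarrow> X\<close> commute when some \<open>\<phi> : K \<times> L \<rightarrow> X\<close> restricts
  to \<open>m\<close> along \<open>\<langle>1, 0\<rangle>\<close> and to \<open>n\<close> along \<open>\<langle>0, 1\<rangle>\<close>.\<close>

definition huq_commute :: "('o, 'm, 'z) category_scheme \<Rightarrow> 'm \<Rightarrow> 'm \<Rightarrow> bool" where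
  "huq_commute C m n \<longleftrightarrow>
     m \<in> arr C \<and> n \<in> arr C \<and> Cod C m = Cod C n \<and>
     (\<forall>P p1 p2. is_product C P p1 p2 (Dom C m) (Dom C n) \<longrightarrow>
        (\<exists>\<phi> \<in> hom C P (Cod C m).
           (\<forall>e \<in> hom C (Dom C m) P.
              p1 \<cdot>\<^bsub>C\<^esub> e = ide C (Dom C m) \<and> p2 \<cdot>\<^bsub>C\<^esub> e = zero_arr C (Dom C m) (Dom C n)
              \<longrightarrow> \<phi> \<cdot>\<^bsub>C\<^esub> e = m) \<and>
           (\<forall>e \<in> hom C (Dom C n) P.
              p1 \<cdot>\<^bsub>C\<^esub> e = zero_arr C (Dom C n) (Dom C m) \<and> p2 \<cdot>\<^bsub>C\<^esub> e = ide C (Dom C n)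
              \<longrightarrow> \<phi> \<cdot>\<^bsub>C\<^esub> e = n)))"

text \<open>Equivalence relations \<open>R\<close>, \<open>S\<close> on \<open>X\<close> centralise each other when there is a connector
  \<open>\<theta> : R \<times>\<^sub>X S \<rightarrow> X\<close>, where \<open>R \<times>\<^sub>X S\<close> consists of the \<open>(x, y, z)\<close> with \<open>x R y\<close> and
  \<open>y S z\<close>, such that \<open>\<theta>(x, y, y) = x\<close> and \<open>\<theta>(y, y, z) = z\<close>. In a Mal'tsev category, in
  particular in a semi-abelian one, the further axioms sometimes imposed on a connector
  follow from these two, and \<open>\<theta>\<close> is unique.\<close>

definition smith_centralise ::
    "('o, 'm, 'z) category_scheme \<Rightarrow> 'o \<Rightarrow> 'o \<Rightarrow> 'm \<Rightarrow> 'm \<Rightarrow> 'o \<Rightarrow> 'm \<Rightarrow> 'm \<Rightarrow> bool" where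
  "smith_centralise C X R r1 r2 S s1 s2 \<longleftrightarrow>
     (\<forall>P p1 p2. is_pullback C P p1 p2 r2 s1 \<longrightarrow>
        (\<exists>\<theta> \<in> hom C P X.
           (\<forall>e \<in> hom C R P.
              p1 \<cdot>\<^bsub>C\<^esub> e = ide C R \<and> s1 \<cdot>\<^bsub>C\<^esub> (p2 \<cdot>\<^bsub>C\<^esub> e) = r2 \<and> s2 \<cdot>\<^bsub>C\<^esub> (p2 \<cdot>\<^bsub>C\<^esub> e) = r2
              \<longrightarrow> \<theta> \<cdot>\<^bsub>C\<^esub> e = r1) \<and>
           (\<forall>e \<in> hom C S P.
              p2 \<cdot>\<^bsub>C\<^esub> e = ide C S \<and> r1 \<cdot>\<^bsub>C\<^esub> (p1 \<cdot>\<^bsub>C\<^esub> e) = s1 \<and> r2 \<cdot>\<^bsub>C\<^esub> (p1 \<cdot>\<^bsub>C\<^esub> e) = s1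
              \<longrightarrow> \<theta> \<cdot>\<^bsub>C\<^esub> e = s2)))"

text \<open>The normalisation of \<open>(R, r\<^sub>1, r\<^sub>2)\<close> is \<open>r\<^sub>2 \<circ> ker r\<^sub>1\<close>.\<close>

definition smith_is_huq :: "('o, 'm, 'z) category_scheme \<Rightarrow> bool" where
  "smith_is_huq C \<longleftrightarrow>
     (\<forall>X R r1 r2 S s1 s2 k l.
        internal_equivalence_relation C X R r1 r2 \<and>
        internal_equivalence_relation C X S s1 s2 \<and>
        is_kernel C k r1 \<and> is_kernel C l s1 \<and>
        huq_commute C (r2 \<cdot>\<^bsub>C\<^esub> k) (s2 \<cdot>\<^bsub>C\<^esub> l)
        \<longrightarrow> smith_centralise C X R r1 r2 S s1 s2)"


section \<open>Chosen binary coproducts, binary products and kernels\<close>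

text \<open>The constructions below use the functorial notation \<open>A + B\<close>, \<open>A \<times> B\<close>, \<open>ker f\<close>, so
  a choice of these (co)limits is carried along as arbitrary data. No coherence between the choices
  is required; in particular \<open>A + B\<close> and \<open>B + A\<close> are identified along \<open>swap\<close>.\<close>

record ('o, 'm) chosen_category = "('o, 'm) category" +
  cop :: "'o \<Rightarrow> 'o \<Rightarrow> 'o"
  inl :: "'o \<Rightarrow> 'o \<Rightarrow> 'm"
  inr :: "'o \<Rightarrow> 'o \<Rightarrow> 'm"
  prd :: "'o \<Rightarrow> 'o \<Rightarrow> 'o"
  prl :: "'o \<Rightarrow> 'o \<Rightarrow> 'm"
  prr :: "'o \<Rightarrow> 'o \<Rightarrow> 'm"
  ker :: "'m \<Rightarrow> 'm"

locale chosen_semi_abelian_category = semi_abelian_category C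
  for C :: "('o, 'm, 'z) chosen_category_scheme" (structure) +
  assumes cop: "\<lbrakk>A \<in> obj C; B \<in> obj C\<rbrakk> \<Longrightarrow> is_coproduct C (cop C A B) (inl C A B) (inr C A B) A B"
    and prd: "\<lbrakk>A \<in> obj C; B \<in> obj C\<rbrakk> \<Longrightarrow> is_product C (prd C A B) (prl C A B) (prr C A B) A B"
    and ker: "f \<in> arr C \<Longrightarrow> is_kernel C (ker C f) f"

definition copair :: "('o, 'm, 'z) chosen_category_scheme \<Rightarrow> 'm \<Rightarrow> 'm \<Rightarrow> 'm" where
  "copair C f g = (THE h. h \<in> hom C (cop C (Dom C f) (Dom C g)) (Cod C f) \<and>
     h \<cdot>\<^bsub>C\<^esub> inl C (Dom C f) (Dom C g) = f \<and> h \<cdot>\<^bsub>C\<^esub> inr C (Dom C f) (Dom C g) = g)"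

definition pair :: "('o, 'm, 'z) chosen_category_scheme \<Rightarrow> 'm \<Rightarrow> 'm \<Rightarrow> 'm" where
  "pair C f g = (THE h. h \<in> hom C (Dom C f) (prd C (Cod C f) (Cod C g)) \<and>
     prl C (Cod C f) (Cod C g) \<cdot>\<^bsub>C\<^esub> h = f \<and> prr C (Cod C f) (Cod C g) \<cdot>\<^bsub>C\<^esub> h = g)"

definition cop_map :: "('o, 'm, 'z) chosen_category_scheme \<Rightarrow> 'm \<Rightarrow> 'm \<Rightarrow> 'm" (infixl "\<oplus>\<index>" 65) where
  "f \<oplus>\<^bsub>C\<^esub> g = copair C (inl C (Cod C f) (Cod C g) \<cdot>\<^bsub>C\<^esub> f) (inr C (Cod C f) (Cod C g) \<cdot>\<^bsub>C\<^esub> g)"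

definition swap :: "('o, 'm, 'z) chosen_category_scheme \<Rightarrow> 'o \<Rightarrow> 'o \<Rightarrow> 'm" where
  "swap C A B = copair C (inr C B A) (inl C B A)"

text \<open>Only meaningful when \<open>k\<close> is monic and \<open>f\<close> factors through it; in every use below \<open>k\<close> is a kernel.\<close>

definition factor :: "('o, 'm, 'z) category_scheme \<Rightarrow> 'm \<Rightarrow> 'm \<Rightarrow> 'm" where
  "factor C k f = (THE u. u \<in> hom C (Dom C f) (Dom C k) \<and> k \<cdot>\<^bsub>C\<^esub> u = f)"


section \<open>Internal actions and crossed modules\<close>

definition kflat :: "('o, 'm, 'z) chosen_category_scheme \<Rightarrow> 'o \<Rightarrow> 'o \<Rightarrow> 'm" where
  "kflat C A B = ker C (copair C (ide C A) (zero_arr C B A))"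

definition flat_obj :: "('o, 'm, 'z) chosen_category_scheme \<Rightarrow> 'o \<Rightarrow> 'o \<Rightarrow> 'o" where
  "flat_obj C A B = Dom C (kflat C A B)"

definition flat_map :: "('o, 'm, 'z) chosen_category_scheme \<Rightarrow> 'm \<Rightarrow> 'm \<Rightarrow> 'm" (infixl "\<flat>\<index>" 80) where
  "f \<flat>\<^bsub>C\<^esub> g = factor C (kflat C (Cod C f) (Cod C g)) ((f \<oplus>\<^bsub>C\<^esub> g) \<cdot>\<^bsub>C\<^esub> kflat C (Dom C f) (Dom C g))"

definition flat_unit :: "('o, 'm, 'z) chosen_category_scheme \<Rightarrow> 'o \<Rightarrow> 'o \<Rightarrow> 'm" where
  "flat_unit C A B = factor C (kflat C A B) (inr C A B)"

definition flat_mult :: "('o, 'm, 'z) chosen_category_scheme \<Rightarrow> 'o \<Rightarrow> 'o \<Rightarrow> 'm" where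
  "flat_mult C A B =
     factor C (kflat C A B) (copair C (inl C A B) (kflat C A B) \<cdot>\<^bsub>C\<^esub> kflat C A (flat_obj C A B))"

definition internal_action ::
    "('o, 'm, 'z) chosen_category_scheme \<Rightarrow> 'o \<Rightarrow> 'o \<Rightarrow> 'm \<Rightarrow> bool" where
  "internal_action C A X \<xi> \<longleftrightarrow>
     A \<in> obj C \<and> X \<in> obj C \<and> \<xi> \<in> hom C (flat_obj C A X) X \<and>
     \<xi> \<cdot>\<^bsub>C\<^esub> flat_unit C A X = ide C X \<and>
     \<xi> \<cdot>\<^bsub>C\<^esub> flat_mult C A X = \<xi> \<cdot>\<^bsub>C\<^esub> (ide C A \<flat>\<^bsub>C\<^esub> \<xi>)"

definition conj_action :: "('o, 'm, 'z) chosen_category_scheme \<Rightarrow> 'o \<Rightarrow> 'm" where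
  "conj_action C A = copair C (ide C A) (ide C A) \<cdot>\<^bsub>C\<^esub> kflat C A A"

definition internal_crossed_module ::
    "('o, 'm, 'z) chosen_category_scheme \<Rightarrow> 'o \<Rightarrow> 'o \<Rightarrow> 'm \<Rightarrow> 'm \<Rightarrow> bool" where
  "internal_crossed_module C X A d \<xi> \<longleftrightarrow>
     d \<in> hom C X A \<and> internal_action C A X \<xi> \<and>
     \<xi> \<cdot>\<^bsub>C\<^esub> (d \<flat>\<^bsub>C\<^esub> ide C X) = conj_action C X \<and>
     d \<cdot>\<^bsub>C\<^esub> \<xi> = conj_action C A \<cdot>\<^bsub>C\<^esub> (ide C A \<flat>\<^bsub>C\<^esub> d)"


section \<open>Cosmash products\<close>

definition hcosmash :: "('o, 'm, 'z) chosen_category_scheme \<Rightarrow> 'o \<Rightarrow> 'o \<Rightarrow> 'm" where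
  "hcosmash C A B = ker C (pair C (copair C (ide C A) (zero_arr C B A))
                                  (copair C (zero_arr C A B) (ide C B)))"

definition cosmash_incl :: "('o, 'm, 'z) chosen_category_scheme \<Rightarrow> 'o \<Rightarrow> 'o \<Rightarrow> 'm" where
  "cosmash_incl C A B = factor C (kflat C A B) (hcosmash C A B)"

text \<open>Ternary coproducts and products are bracketed to the left:
  \<open>(A + B) + D\<close> and \<open>((A + B) \<times> (A + D)) \<times> (B + D)\<close>.\<close>

definition hcosmash3 :: "('o, 'm, 'z) chosen_category_scheme \<Rightarrow> 'o \<Rightarrow> 'o \<Rightarrow> 'o \<Rightarrow> 'm" where
  "hcosmash3 C A B D = ker C (pair C (pair C
     (copair C (copair C (inl C A B) (inr C A B)) (zero_arr C D (cop C A B)))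
     (copair C (copair C (inl C A D) (zero_arr C B (cop C A D))) (inr C A D)))
     (copair C (copair C (zero_arr C A (cop C B D)) (inl C B D)) (inr C B D)))"

definition jcosmash3 :: "('o, 'm, 'z) chosen_category_scheme \<Rightarrow> 'o \<Rightarrow> 'o \<Rightarrow> 'o \<Rightarrow> 'm" where
  "jcosmash3 C A B D = factor C (kflat C (cop C A B) D) (hcosmash3 C A B D)"

text \<open>The two folding morphisms, \<open>fold_outer C N M : M \<diamond> N \<diamond> M \<rightarrow> N \<diamond> M\<close> for
  \<open>S\<^bsub>1,2\<^esub>\<^bsup>N,M\<^esup>\<close> and \<open>fold_right C M N : M \<diamond> N \<diamond> N \<rightarrow> M \<diamond> N\<close> for \<open>S\<^bsub>1,2\<^esub>\<^bsup>M,N\<^esup>\<close>. The first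
  lands in \<open>N + M\<close>, so it already contains the identification of \<open>M + N\<close> with \<open>N + M\<close>.\<close>

definition fold_outer :: "('o, 'm, 'z) chosen_category_scheme \<Rightarrow> 'o \<Rightarrow> 'o \<Rightarrow> 'm" where
  "fold_outer C N M = factor C (hcosmash C N M)
     (copair C (copair C (inr C N M) (inl C N M)) (inr C N M) \<cdot>\<^bsub>C\<^esub> hcosmash3 C M N M)"

definition fold_right :: "('o, 'm, 'z) chosen_category_scheme \<Rightarrow> 'o \<Rightarrow> 'o \<Rightarrow> 'm" where
  "fold_right C M N = factor C (hcosmash C M N)
     (copair C (copair C (inl C M N) (inr C M N)) (inr C M N) \<cdot>\<^bsub>C\<^esub> hcosmash3 C M N N)"


section \<open>Compatible actions and the Peiffer product\<close>

text \<open>The two morphisms \<open>(N \<flat> M) + (M \<flat> N) \<rightarrow> M + N\<close>. Since \<open>k\<^bsub>N,M\<^esub>\<close> lands in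
  \<open>N + M\<close>, it is followed by the identification with \<open>M + N\<close>.\<close>

definition peiffer_k :: "('o, 'm, 'z) chosen_category_scheme \<Rightarrow> 'o \<Rightarrow> 'o \<Rightarrow> 'm" where
  "peiffer_k C M N = copair C (swap C N M \<cdot>\<^bsub>C\<^esub> kflat C N M) (kflat C M N)"

definition peiffer_xi :: "('o, 'm, 'z) chosen_category_scheme \<Rightarrow> 'm \<Rightarrow> 'm \<Rightarrow> 'm" where
  "peiffer_xi C \<xi>MN \<xi>NM = \<xi>NM \<oplus>\<^bsub>C\<^esub> \<xi>MN"

text \<open>\<open>\<xi>MN : M \<flat> N \<rightarrow> N\<close> and \<open>\<xi>NM : N \<flat> M \<rightarrow> M\<close> are the given actions, and
  \<open>\<xi>M : (M + N) \<flat> M \<rightarrow> M\<close> and \<open>\<xi>N : (M + N) \<flat> N \<rightarrow> N\<close> those witnessing the compatibility.\<close>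

definition compatibility_witness ::
    "('o, 'm, 'z) chosen_category_scheme \<Rightarrow> 'o \<Rightarrow> 'o \<Rightarrow> 'm \<Rightarrow> 'm \<Rightarrow> 'm \<Rightarrow> 'm \<Rightarrow> bool" where
  "compatibility_witness C M N \<xi>MN \<xi>NM \<xi>M \<xi>N \<longleftrightarrow>
     internal_action C (cop C M N) M \<xi>M \<and> internal_action C (cop C M N) N \<xi>N \<and>
     \<xi>M \<cdot>\<^bsub>C\<^esub> (inr C M N \<flat>\<^bsub>C\<^esub> ide C M) = \<xi>NM \<and>
     \<xi>M \<cdot>\<^bsub>C\<^esub> (inl C M N \<flat>\<^bsub>C\<^esub> ide C M) = conj_action C M \<and>
     \<xi>M \<cdot>\<^bsub>C\<^esub> jcosmash3 C M N M = \<xi>NM \<cdot>\<^bsub>C\<^esub> (cosmash_incl C N M \<cdot>\<^bsub>C\<^esub> fold_outer C N M) \<and>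
     \<xi>N \<cdot>\<^bsub>C\<^esub> (inl C M N \<flat>\<^bsub>C\<^esub> ide C N) = \<xi>MN \<and>
     \<xi>N \<cdot>\<^bsub>C\<^esub> (inr C M N \<flat>\<^bsub>C\<^esub> ide C N) = conj_action C N \<and>
     \<xi>N \<cdot>\<^bsub>C\<^esub> jcosmash3 C M N N = \<xi>MN \<cdot>\<^bsub>C\<^esub> (cosmash_incl C M N \<cdot>\<^bsub>C\<^esub> fold_right C M N) \<and>
     \<xi>M \<cdot>\<^bsub>C\<^esub> (peiffer_xi C \<xi>MN \<xi>NM \<flat>\<^bsub>C\<^esub> ide C M) = \<xi>M \<cdot>\<^bsub>C\<^esub> (peiffer_k C M N \<flat>\<^bsub>C\<^esub> ide C M) \<and>
     \<xi>N \<cdot>\<^bsub>C\<^esub> (peiffer_xi C \<xi>MN \<xi>NM \<flat>\<^bsub>C\<^esub> ide C N) = \<xi>N \<cdot>\<^bsub>C\<^esub> (peiffer_k C M N \<flat>\<^bsub>C\<^esub> ide C N)"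

definition compatible_actions ::
    "('o, 'm, 'z) chosen_category_scheme \<Rightarrow> 'o \<Rightarrow> 'o \<Rightarrow> 'm \<Rightarrow> 'm \<Rightarrow> bool" where
  "compatible_actions C M N \<xi>MN \<xi>NM \<longleftrightarrow>
     internal_action C M N \<xi>MN \<and> internal_action C N M \<xi>NM \<and>
     (\<exists>\<xi>M \<xi>N. compatibility_witness C M N \<xi>MN \<xi>NM \<xi>M \<xi>N)"

definition is_peiffer_product ::
    "('o, 'm, 'z) chosen_category_scheme \<Rightarrow> 'o \<Rightarrow> 'o \<Rightarrow> 'm \<Rightarrow> 'm \<Rightarrow> 'm \<Rightarrow> bool" where
  "is_peiffer_product C M N \<xi>MN \<xi>NM q \<longleftrightarrow>
     is_coequalizer C q (peiffer_k C M N) (peiffer_xi C \<xi>MN \<xi>NM)"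

end

theory Submission
  imports Defs
begin

text \<open>By protomodularity, the canonical morphisms to \<open>(M + N) \<flat> X\<close> from \<open>M \<flat> X\<close>, from \<open>N \<flat> X\<close> and
  from the ternary cosmash product \<open>M \<diamond> N \<diamond> X\<close> are jointly epic. On these three pieces the precrossed
  module identity for \<open>l\<^sub>M\<close> and \<open>\<xi>\<^sup>M\<^sup>+\<^sup>N\<^sub>M\<close>, composed with \<open>q\<close>, reduces to the defining
  equations of the Peiffer product. All identities over the Peiffer product follow from identities
  over \<open>M + N\<close>, because \<open>f \<flat> g\<close> is a strong epimorphism when \<open>f\<close> and \<open>g\<close> are; this makes
  \<open>q \<flat> (q \<flat> 1)\<close> epic, as needed for the associativity of the action.\<close>

section \<open>Composition and zero morphisms\<close>

text \<open>Subobjects stand in for elements. Joint epicness is obtained in a stronger, extremal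
  form: a monomorphism through which all members of the family factor has a right inverse. Taking an
  equaliser for this monomorphism gives cancellation. Membership in a subobject can be tested on the
  section and the kernel of a point, by protomodularity, and after a strong epimorphism, which
  regularity supplies through local lifting.

  The three pieces of \<open>(M + N) \<flat> X\<close> are the right ones because (CA.0) prescribes
  the actions of \<open>M + N\<close> exactly on them.

  The obstacle to descent is that \<open>f \<flat> g\<close> is a restriction of
  \<open>f + g\<close> to kernels, and an arrow induced on kernels by strong epimorphisms need not
  be a strong epimorphism. What rescues it is that the kernels belong to split epimorphisms whose
  sections are respected by \<open>f + g\<close>.\<close>

lemma ex1_eqD: "\<lbrakk>\<exists>!x. P x; P a; P b\<rbrakk> \<Longrightarrow> a = b"
  by blast

context category
begin

lemma in_homI: "\<lbrakk>f \<in> arr C; Dom C f = A; Cod C f = B\<rbrakk> \<Longrightarrow> f \<in> hom C A B"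
  by (simp add: hom_def)

lemma in_homE: "f \<in> hom C A B \<Longrightarrow> f \<in> arr C \<and> Dom C f = A \<and> Cod C f = B"
  by (simp add: hom_def)

lemma Dom_in_obj [simp]: "f \<in> arr C \<Longrightarrow> Dom C f \<in> obj C"
  and Cod_in_obj [simp]: "f \<in> arr C \<Longrightarrow> Cod C f \<in> obj C"
  by (simp_all add: Dom_obj Cod_obj)

lemma ide_arr [simp]:
  assumes "A \<in> obj C"
  shows "ide C A \<in> arr C" "Dom C (ide C A) = A" "Cod C (ide C A) = A"
  using ide_hom [OF assms] by (auto simp: hom_def)

lemma comp_arr [simp]:
  assumes "f \<in> arr C" "g \<in> arr C" "Cod C f = Dom C g"
  shows "g \<cdot> f \<in> arr C" "Dom C (g \<cdot> f) = Dom C f" "Cod C (g \<cdot> f) = Cod C g"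
  using cmp_hom [of f "Dom C f" "Dom C g" g "Cod C g"] assms by (auto simp: hom_def)

lemma comp_ide [simp]:
  "\<lbrakk>f \<in> arr C; Dom C f = A\<rbrakk> \<Longrightarrow> f \<cdot> ide C A = f"
  "\<lbrakk>f \<in> arr C; Cod C f = A\<rbrakk> \<Longrightarrow> ide C A \<cdot> f = f"
  using cmp_ide [of f A "Cod C f"] ide_cmp [of f "Dom C f" A] by (auto simp: hom_def)

lemma comp_assoc:
  "\<lbrakk>f \<in> arr C; g \<in> arr C; h \<in> arr C; Cod C f = Dom C g; Cod C g = Dom C h\<rbrakk>
    \<Longrightarrow> (h \<cdot> g) \<cdot> f = h \<cdot> (g \<cdot> f)"
  by (rule cmp_assoc) (auto simp: hom_def)

text \<open>Composites are kept nested to the right, so an equation between two composites does not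
  match inside a longer one. This form applies it in front of a further arrow \<open>x\<close>;
  \<open>comp_eq_reassoc1\<close> is the variant with a single arrow on the right.\<close>

lemma comp_eq_reassoc:
  assumes "g \<cdot> f = g' \<cdot> f'"
    and "f \<in> arr C" "g \<in> arr C" "f' \<in> arr C" "g' \<in> arr C" "x \<in> arr C"
    and "Cod C f = Dom C g" "Cod C f' = Dom C g'" "Cod C x = Dom C f" "Cod C x = Dom C f'"
  shows "g \<cdot> (f \<cdot> x) = g' \<cdot> (f' \<cdot> x)"
  using assms by (metis comp_assoc)

lemma comp_eq_reassoc1:
  assumes "g \<cdot> f = h"
    and "f \<in> arr C" "g \<in> arr C" "x \<in> arr C" "Cod C f = Dom C g" "Cod C x = Dom C f"
  shows "g \<cdot> (f \<cdot> x) = h \<cdot> x"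
  using assms by (metis comp_assoc)

end

section \<open>Zero morphisms\<close>

context semi_abelian_category
begin

text \<open>The arrow between the two zero objects is compatible with both legs, by terminality of
  \<open>Z'\<close> on one side and initiality of \<open>Z\<close> on the other. This makes the
  description operator in \<open>zero_arr\<close> meaningful.\<close>

lemma zero_arr_unique:
  assumes "A \<in> obj C" "B \<in> obj C"
    and "is_zero_object C Z" "a \<in> hom C A Z" "b \<in> hom C Z B"
    and "is_zero_object C Z'" "a' \<in> hom C A Z'" "b' \<in> hom C Z' B"
  shows "b \<cdot> a = b' \<cdot> a'"
proof -
  have Z: "Z \<in> obj C" "Z' \<in> obj C"
    and term_ex1: "\<And>X. X \<in> obj C \<Longrightarrow> \<exists>!f. f \<in> hom C X Z'"
    and init_ex1: "\<And>X. X \<in> obj C \<Longrightarrow> \<exists>!f. f \<in> hom C Z X"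
    using assms unfolding is_zero_object_def is_terminal_def is_initial_def by auto
  obtain i where i: "i \<in> hom C Z Z'" using term_ex1 Z by blast
  have "i \<cdot> a \<in> hom C A Z'" using i assms cmp_hom by blast
  then have 1: "i \<cdot> a = a'" using term_ex1 assms by blast
  have "b' \<cdot> i \<in> hom C Z B" using i assms cmp_hom by blast
  then have 2: "b' \<cdot> i = b" using init_ex1 assms by blast
  have "b \<cdot> a = (b' \<cdot> i) \<cdot> a" using 2 by simp
  also have "\<dots> = b' \<cdot> (i \<cdot> a)" using i assms cmp_assoc by blast
  finally show ?thesis using 1 by simp
qed

lemma zero_arrI:
  assumes "A \<in> obj C" "B \<in> obj C" "is_zero_object C Z" "a \<in> hom C A Z" "b \<in> hom C Z B"
  shows "zero_arr C A B = b \<cdot> a"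
  unfolding zero_arr_def
proof (rule the_equality)
  show "\<exists>Z. is_zero_object C Z \<and> (\<exists>a' \<in> hom C A Z. \<exists>b' \<in> hom C Z B. b \<cdot> a = b' \<cdot> a')"
    using assms by blast
next
  fix f
  assume "\<exists>Z. is_zero_object C Z \<and> (\<exists>a \<in> hom C A Z. \<exists>b \<in> hom C Z B. f = b \<cdot> a)"
  then show "f = b \<cdot> a" using zero_arr_unique assms by blast
qed

lemma zero_arr_through:
  assumes "A \<in> obj C" "B \<in> obj C"
  obtains Z a b where "is_zero_object C Z" "a \<in> hom C A Z" "b \<in> hom C Z B" "zero_arr C A B = b \<cdot> a"
proof -
  obtain Z where Z: "is_zero_object C Z" using pointed by blast
  then obtain a b where "a \<in> hom C A Z" "b \<in> hom C Z B"
    using assms unfolding is_zero_object_def is_terminal_def is_initial_def by blast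
  then show thesis using that Z zero_arrI assms by blast
qed

lemma zero_arr_arr [simp]:
  assumes "A \<in> obj C" "B \<in> obj C"
  shows "zero_arr C A B \<in> arr C" "Dom C (zero_arr C A B) = A" "Cod C (zero_arr C A B) = B"
proof -
  obtain Z a b where "a \<in> hom C A Z" "b \<in> hom C Z B" "zero_arr C A B = b \<cdot> a"
    by (rule zero_arr_through [OF assms])
  then have "zero_arr C A B \<in> hom C A B" using cmp_hom by simp
  then show "zero_arr C A B \<in> arr C" "Dom C (zero_arr C A B) = A" "Cod C (zero_arr C A B) = B"
    by (auto simp: hom_def)
qed

lemma comp_zero [simp]:
  assumes "g \<in> arr C" "A \<in> obj C" "Dom C g = B"
  shows "g \<cdot> zero_arr C A B = zero_arr C A (Cod C g)"
proof -
  have B: "B \<in> obj C" using assms by auto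
  obtain Z a b where *: "is_zero_object C Z" "a \<in> hom C A Z" "b \<in> hom C Z B" "zero_arr C A B = b \<cdot> a"
    using zero_arr_through assms B by blast
  have g: "g \<in> hom C B (Cod C g)" using assms by (simp add: hom_def)
  then have "zero_arr C A (Cod C g) = (g \<cdot> b) \<cdot> a"
    using zero_arrI [of A "Cod C g" Z a "g \<cdot> b"] * assms cmp_hom by auto
  then show ?thesis using * g cmp_assoc by metis
qed

lemma zero_comp [simp]:
  assumes "g \<in> arr C" "D \<in> obj C" "Cod C g = B"
  shows "zero_arr C B D \<cdot> g = zero_arr C (Dom C g) D"
proof -
  have B: "B \<in> obj C" using assms by auto
  obtain Z a b where *: "is_zero_object C Z" "a \<in> hom C B Z" "b \<in> hom C Z D" "zero_arr C B D = b \<cdot> a"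
    using zero_arr_through assms B by blast
  have g: "g \<in> hom C (Dom C g) B" using assms by (simp add: hom_def)
  then have "zero_arr C (Dom C g) D = b \<cdot> (a \<cdot> g)"
    using zero_arrI [of "Dom C g" D Z "a \<cdot> g" b] * assms cmp_hom by auto
  then show ?thesis using * g cmp_assoc by metis
qed

lemma zero_object_arr_unique:
  assumes "is_zero_object C Z" "f \<in> arr C" "g \<in> arr C" "Dom C f = Dom C g" "Cod C f = Z" "Cod C g = Z"
  shows "f = g"
proof -
  have "\<exists>!h. h \<in> hom C (Dom C f) Z"
    using assms unfolding is_zero_object_def is_terminal_def by simp
  then show ?thesis using assms by (auto simp: hom_def)
qed

end

section \<open>Monomorphisms, strong epimorphisms and pullbacks\<close>

definition monic :: "('o, 'm, 'z) category_scheme \<Rightarrow> 'm \<Rightarrow> bool" where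
  "monic C m \<longleftrightarrow> m \<in> arr C \<and>
     (\<forall>f \<in> arr C. \<forall>g \<in> arr C. Dom C f = Dom C g \<and> Cod C f = Dom C m \<and> Cod C g = Dom C m
        \<and> m \<cdot>\<^bsub>C\<^esub> f = m \<cdot>\<^bsub>C\<^esub> g \<longrightarrow> f = g)"

text \<open>For monic \<open>e\<close> this expresses that the generalised element \<open>u\<close>
  belongs to the subobject \<open>e\<close>.\<close>

definition factors_through :: "('o, 'm, 'z) category_scheme \<Rightarrow> 'm \<Rightarrow> 'm \<Rightarrow> bool" where
  "factors_through C u e \<longleftrightarrow>
     (\<exists>d \<in> arr C. Dom C d = Dom C u \<and> Cod C d = Dom C e \<and> u = e \<cdot>\<^bsub>C\<^esub> d)"

text \<open>Only the lower triangle of the diagonal fill-in is demanded; the upper one follows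
  because \<open>m\<close> is monic. That such arrows are epic is derived from equalisers in
  \<open>strong_epi_epi\<close>.\<close>

definition strong_epi :: "('o, 'm, 'z) category_scheme \<Rightarrow> 'm \<Rightarrow> bool" where
  "strong_epi C f \<longleftrightarrow> f \<in> arr C \<and>
     (\<forall>m g. monic C m \<and> g \<in> arr C \<and> Dom C g = Cod C f \<and> Cod C g = Cod C m
        \<and> factors_through C (g \<cdot>\<^bsub>C\<^esub> f) m \<longrightarrow> factors_through C g m)"

context category
begin

lemma monic_arr: "monic C m \<Longrightarrow> m \<in> arr C"
  by (simp add: monic_def)

lemma monicD:
  "\<lbrakk>monic C m; m \<cdot> f = m \<cdot> g; f \<in> arr C; g \<in> arr C; Cod C f = Dom C m; Cod C g = Dom C m\<rbrakk>
    \<Longrightarrow> f = g"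
  unfolding monic_def by (metis comp_arr(2))

lemma factors_throughI:
  "\<lbrakk>u = e \<cdot> d; d \<in> arr C; e \<in> arr C; Cod C d = Dom C e\<rbrakk> \<Longrightarrow> factors_through C u e"
  unfolding factors_through_def by auto

lemma factors_throughE:
  assumes "factors_through C u e"
  obtains d where "d \<in> arr C" "Dom C d = Dom C u" "Cod C d = Dom C e" "u = e \<cdot> d"
  using assms unfolding factors_through_def by auto

lemma factors_throughD:
  "\<lbrakk>factors_through C u e; Dom C u = A\<rbrakk>
    \<Longrightarrow> \<exists>d. d \<in> arr C \<and> Dom C d = A \<and> Cod C d = Dom C e \<and> u = e \<cdot> d"
  unfolding factors_through_def by auto

lemma factors_through_comp:
  assumes "factors_through C u e" "e \<in> arr C" "x \<in> arr C" "Cod C x = Dom C u"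
  shows "factors_through C (u \<cdot> x) e"
proof -
  obtain d where d: "d \<in> arr C" "Dom C d = Dom C u" "Cod C d = Dom C e" "u = e \<cdot> d"
    using assms(1) by (rule factors_throughE)
  show ?thesis
    by (rule factors_throughI [of _ _ "d \<cdot> x"]) (use d assms in \<open>simp_all add: comp_assoc\<close>)
qed

lemma strong_epi_arr: "strong_epi C f \<Longrightarrow> f \<in> arr C"
  by (simp add: strong_epi_def)

lemma strong_epiD:
  "\<lbrakk>strong_epi C f; monic C m; g \<in> arr C; Dom C g = Cod C f; Cod C g = Cod C m;
    factors_through C (g \<cdot> f) m\<rbrakk> \<Longrightarrow> factors_through C g m"
  unfolding strong_epi_def by blast

text \<open>The identity takes the place of \<open>g\<close> in the lifting property. The
  monomorphism \<open>m\<close> thus gets a right inverse and is an isomorphism.\<close>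

lemma strong_epi_extremal:
  assumes "strong_epi C f" "monic C m" "Cod C m = Cod C f" "factors_through C f m"
  shows "factors_through C (ide C (Cod C f)) m"
  using strong_epiD [of f m "ide C (Cod C f)"] strong_epi_arr [of f] assms by simp

lemma strong_epi_comp:
  assumes f: "strong_epi C f" and g: "strong_epi C g" and c: "Cod C f = Dom C g"
  shows "strong_epi C (g \<cdot> f)"
  unfolding strong_epi_def
proof (intro conjI allI impI)
  note [simp] = strong_epi_arr [OF f] strong_epi_arr [OF g] c
  show "g \<cdot> f \<in> arr C" by simp
  fix m h
  assume *: "monic C m \<and> h \<in> arr C \<and> Dom C h = Cod C (g \<cdot> f) \<and> Cod C h = Cod C m
    \<and> factors_through C (h \<cdot> (g \<cdot> f)) m"
  then have "factors_through C ((h \<cdot> g) \<cdot> f) m" by (simp add: comp_assoc)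
  then have "factors_through C (h \<cdot> g) m"
    using strong_epiD [OF f, of m "h \<cdot> g"] * by simp
  then show "factors_through C h m"
    using strong_epiD [OF g, of m h] * by simp
qed

lemma strong_epi_ide: "A \<in> obj C \<Longrightarrow> strong_epi C (ide C A)"
  unfolding strong_epi_def by auto

section \<open>Coequalisers\<close>

lemma coequalizer_universal:
  assumes "is_coequalizer C q a b" "T \<in> obj C" "t \<in> hom C (Cod C a) T" "t \<cdot> a = t \<cdot> b"
  shows "\<exists>!h. h \<in> hom C (Cod C q) T \<and> h \<cdot> q = t"
  using assms by (simp only: is_coequalizer_def)

lemma coequalizer_epi:
  assumes "is_coequalizer C q a b" "f \<in> arr C" "g \<in> arr C" "Dom C f = Cod C q" "Dom C g = Cod C q"
    and "f \<cdot> q = g \<cdot> q"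
  shows "f = g"
proof -
  have q: "a \<in> arr C" "b \<in> arr C" "Dom C b = Dom C a" "Cod C b = Cod C a" "q \<in> arr C"
    "Dom C q = Cod C a" "q \<cdot> a = q \<cdot> b"
    using assms(1) unfolding is_coequalizer_def by (auto simp: hom_def)
  have cod: "Cod C g = Cod C f"
    using comp_arr(3) [of q f] comp_arr(3) [of q g] assms q by metis
  have "(f \<cdot> q) \<cdot> a = (f \<cdot> q) \<cdot> b" using assms q by (simp add: comp_assoc)
  moreover have "f \<cdot> q \<in> hom C (Cod C a) (Cod C f)" using assms(1-5) q by (simp add: hom_def)
  moreover have "Cod C f \<in> obj C" using assms by simp
  ultimately have "\<exists>!h. h \<in> hom C (Cod C q) (Cod C f) \<and> h \<cdot> q = f \<cdot> q"
    by (intro coequalizer_universal [OF assms(1)])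
  then show ?thesis by (rule ex1_eqD) (use assms cod in \<open>simp_all add: hom_def\<close>)
qed

lemma coequalizer_factor:
  assumes "is_coequalizer C q a b" "t \<in> arr C" "Dom C t = Cod C a" "t \<cdot> a = t \<cdot> b"
  obtains h where "h \<in> arr C" "Dom C h = Cod C q" "Cod C h = Cod C t" "h \<cdot> q = t"
proof -
  have "t \<in> hom C (Cod C a) (Cod C t)" "Cod C t \<in> obj C" using assms by (simp_all add: hom_def)
  then have "\<exists>!h. h \<in> hom C (Cod C q) (Cod C t) \<and> h \<cdot> q = t"
    by (intro coequalizer_universal [OF assms(1)] assms(4))
  then show thesis using that by (auto simp: hom_def)
qed

text \<open>The factor \<open>w\<close> of \<open>g \<cdot> q\<close> through \<open>m\<close>
  identifies \<open>a\<close> and \<open>b\<close> because \<open>m\<close> is monic, so it descends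
  along \<open>q\<close>. The descended arrow is the diagonal, since \<open>q\<close> can be
  cancelled.\<close>

lemma coequalizer_strong_epi:
  assumes co: "is_coequalizer C q a b"
  shows "strong_epi C q"
  unfolding strong_epi_def
proof (intro conjI allI impI)
  have q [simp]: "a \<in> arr C" "b \<in> arr C" "Dom C b = Dom C a" "Cod C b = Cod C a" "q \<in> arr C"
    "Dom C q = Cod C a"
    using co unfolding is_coequalizer_def by (auto simp: hom_def)
  have qab: "q \<cdot> a = q \<cdot> b" using co unfolding is_coequalizer_def by blast
  show "q \<in> arr C" by simp
  fix m g
  assume *: "monic C m \<and> g \<in> arr C \<and> Dom C g = Cod C q \<and> Cod C g = Cod C m
    \<and> factors_through C (g \<cdot> q) m"
  then obtain w where w: "w \<in> arr C" "Dom C w = Dom C (g \<cdot> q)" "Cod C w = Dom C m" "g \<cdot> q = m \<cdot> w"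
    by (auto elim: factors_throughE)
  note [simp] = w(1,3) * monic_arr [of m]
  have [simp]: "Dom C w = Cod C a" using w(2) by simp
  have "m \<cdot> (w \<cdot> a) = g \<cdot> (q \<cdot> a)"
    by (rule comp_eq_reassoc [OF w(4) [symmetric]]) simp_all
  also have "\<dots> = m \<cdot> (w \<cdot> b)"
    unfolding qab by (rule comp_eq_reassoc [OF w(4)]) simp_all
  finally have "w \<cdot> a = w \<cdot> b" by (rule monicD [rotated]) (simp_all add: *)
  then obtain d where d: "d \<in> arr C" "Dom C d = Cod C q" "Cod C d = Cod C w" "d \<cdot> q = w"
    using coequalizer_factor [OF co, of w] by auto
  have "(m \<cdot> d) \<cdot> q = g \<cdot> q" using d w by (simp add: comp_assoc)
  then have "m \<cdot> d = g" by (rule coequalizer_epi [OF co, rotated 4]) (use d in simp_all)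
  then show "factors_through C g m" using d by (auto intro: factors_throughI)
qed

section \<open>Pullbacks\<close>

lemma pullbackD:
  assumes "is_pullback C P p1 p2 f g"
  shows "f \<in> arr C" "g \<in> arr C" "Cod C f = Cod C g"
    "p1 \<in> arr C" "Dom C p1 = P" "Cod C p1 = Dom C f"
    "p2 \<in> arr C" "Dom C p2 = P" "Cod C p2 = Dom C g" "f \<cdot> p1 = g \<cdot> p2"
  using assms unfolding is_pullback_def by (auto simp: hom_def)

lemma pullback_universal:
  assumes "is_pullback C P p1 p2 f g" "T \<in> obj C" "a \<in> hom C T (Dom C f)" "b \<in> hom C T (Dom C g)"
    and "f \<cdot> a = g \<cdot> b"
  shows "\<exists>!h. h \<in> hom C T P \<and> p1 \<cdot> h = a \<and> p2 \<cdot> h = b"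
  using assms by (simp only: is_pullback_def)

lemma pullback_factor:
  assumes "is_pullback C P p1 p2 f g"
    and "a \<in> arr C" "b \<in> arr C" "Dom C a = Dom C b" "Cod C a = Dom C f" "Cod C b = Dom C g"
    and "f \<cdot> a = g \<cdot> b"
  obtains h where "h \<in> arr C" "Dom C h = Dom C a" "Cod C h = P" "p1 \<cdot> h = a" "p2 \<cdot> h = b"
proof -
  have "a \<in> hom C (Dom C a) (Dom C f)" "b \<in> hom C (Dom C a) (Dom C g)" "Dom C a \<in> obj C"
    using assms by (simp_all add: hom_def)
  then have "\<exists>!h. h \<in> hom C (Dom C a) P \<and> p1 \<cdot> h = a \<and> p2 \<cdot> h = b"
    by (intro pullback_universal [OF assms(1)] assms(7))
  then show thesis using that by (auto simp: hom_def)
qed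

lemma pullback_ext:
  assumes pb: "is_pullback C P p1 p2 f g"
    and [simp]: "x \<in> arr C" "y \<in> arr C" "Cod C x = P" "Cod C y = P"
    and eq: "p1 \<cdot> x = p1 \<cdot> y" "p2 \<cdot> x = p2 \<cdot> y"
  shows "x = y"
proof -
  note [simp] = pullbackD [OF pb]
  have dom: "Dom C y = Dom C x" using eq(1) by (metis assms(2-5) comp_arr(2) pullbackD(4,5) pb)
  have "p1 \<cdot> x \<in> hom C (Dom C x) (Dom C f)" "p2 \<cdot> x \<in> hom C (Dom C x) (Dom C g)"
    by (simp_all add: hom_def)
  moreover have "f \<cdot> (p1 \<cdot> x) = g \<cdot> (p2 \<cdot> x)"
    by (rule comp_eq_reassoc) simp_all
  moreover have "Dom C x \<in> obj C" by simp
  ultimately have "\<exists>!h. h \<in> hom C (Dom C x) P \<and> p1 \<cdot> h = p1 \<cdot> x \<and> p2 \<cdot> h = p2 \<cdot> x"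
    by (intro pullback_universal [OF pb])
  then show ?thesis by (rule ex1_eqD) (simp_all add: hom_def eq dom)
qed

lemma pullback_monic:
  assumes pb: "is_pullback C P p1 p2 f g" and g: "monic C g"
  shows "monic C p1"
  unfolding monic_def
proof (intro conjI ballI impI)
  note [simp] = pullbackD(1-9) [OF pb]
  show "p1 \<in> arr C" by simp
  fix x y
  assume [simp]: "x \<in> arr C" "y \<in> arr C"
  assume *: "Dom C x = Dom C y \<and> Cod C x = Dom C p1 \<and> Cod C y = Dom C p1 \<and> p1 \<cdot> x = p1 \<cdot> y"
  then have [simp]: "Cod C x = P" "Cod C y = P" by simp_all
  note fp = pullbackD(10) [OF pb]
  have "g \<cdot> (p2 \<cdot> x) = f \<cdot> (p1 \<cdot> x)"
    by (rule comp_eq_reassoc [OF fp [symmetric]]) simp_all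
  also have "\<dots> = g \<cdot> (p2 \<cdot> y)"
    using * comp_eq_reassoc [OF fp, of y] by simp
  finally have p2: "p2 \<cdot> x = p2 \<cdot> y" by (rule monicD [OF g]) simp_all
  have "p1 \<cdot> x = p1 \<cdot> y" using * by blast
  then show "x = y" using p2 by (rule pullback_ext [OF pb, rotated 4]) simp_all
qed

end

section \<open>Chosen limits and colimits\<close>

context chosen_semi_abelian_category
begin

section \<open>Kernels\<close>

lemma kernel_universal:
  assumes "is_kernel C k f" "T \<in> obj C" "t \<in> hom C T (Dom C f)" "f \<cdot> t = zero_arr C T (Cod C f)"
  shows "\<exists>!h. h \<in> hom C T (Dom C k) \<and> k \<cdot> h = t"
  using assms by (simp only: is_kernel_def)

lemma ker_arr [simp]:
  assumes "f \<in> arr C"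
  shows "ker C f \<in> arr C" "Cod C (ker C f) = Dom C f"
    "f \<cdot> ker C f = zero_arr C (Dom C (ker C f)) (Cod C f)"
  using ker [OF assms] unfolding is_kernel_def by simp_all

lemma ker_factors:
  assumes "f \<in> arr C" "x \<in> arr C" "Cod C x = Dom C f" "f \<cdot> x = zero_arr C (Dom C x) (Cod C f)"
  shows "factors_through C x (ker C f)"
proof -
  have "\<exists>!h. h \<in> hom C (Dom C x) (Dom C (ker C f)) \<and> ker C f \<cdot> h = x"
    using assms by (intro kernel_universal [OF ker]) (simp_all add: hom_def)
  then obtain h where "h \<in> hom C (Dom C x) (Dom C (ker C f))" "ker C f \<cdot> h = x" by blast
  then show ?thesis using assms by (intro factors_throughI [of _ _ h]) (auto simp: hom_def)
qed

lemma ker_monic: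
  assumes f [simp]: "f \<in> arr C"
  shows "monic C (ker C f)"
  unfolding monic_def
proof (intro conjI ballI impI)
  show "ker C f \<in> arr C" by simp
  fix x y
  assume [simp]: "x \<in> arr C" "y \<in> arr C"
  assume *: "Dom C x = Dom C y \<and> Cod C x = Dom C (ker C f) \<and> Cod C y = Dom C (ker C f)
    \<and> ker C f \<cdot> x = ker C f \<cdot> y"
  then have [simp]: "Dom C x = Dom C y" "Cod C x = Dom C (ker C f)" "Cod C y = Dom C (ker C f)"
    by blast+
  have "f \<cdot> (ker C f \<cdot> y) = zero_arr C (Dom C y) (Cod C f)"
    using comp_eq_reassoc1 [OF ker_arr(3) [OF f], of y] by simp
  then have ex1: "\<exists>!h. h \<in> hom C (Dom C y) (Dom C (ker C f)) \<and> ker C f \<cdot> h = ker C f \<cdot> y"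
    by (intro kernel_universal [OF ker]) (simp_all add: hom_def)
  have "ker C f \<cdot> x = ker C f \<cdot> y" using * by blast
  then show "x = y" by (intro ex1_eqD [OF ex1]) (simp_all add: hom_def)
qed

section \<open>Binary coproducts\<close>

lemma inj_arr [simp]:
  assumes "A \<in> obj C" "B \<in> obj C"
  shows "inl C A B \<in> arr C" "Dom C (inl C A B) = A" "Cod C (inl C A B) = cop C A B"
    "inr C A B \<in> arr C" "Dom C (inr C A B) = B" "Cod C (inr C A B) = cop C A B"
  using cop [OF assms] unfolding is_coproduct_def by (simp_all add: hom_def)

lemma cop_in_obj [simp]:
  assumes "A \<in> obj C" "B \<in> obj C"
  shows "cop C A B \<in> obj C"
  using Cod_in_obj [OF inj_arr(1) [OF assms]] assms by simp

lemma coproduct_universal: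
  assumes "is_coproduct C S i1 i2 A B" "T \<in> obj C" "f \<in> hom C A T" "g \<in> hom C B T"
  shows "\<exists>!h. h \<in> hom C S T \<and> h \<cdot> i1 = f \<and> h \<cdot> i2 = g"
  using assms by (simp only: is_coproduct_def)

lemma copair_ex1:
  assumes "f \<in> arr C" "g \<in> arr C" "Cod C f = Cod C g"
  shows "\<exists>!h. h \<in> hom C (cop C (Dom C f) (Dom C g)) (Cod C f)
    \<and> h \<cdot> inl C (Dom C f) (Dom C g) = f \<and> h \<cdot> inr C (Dom C f) (Dom C g) = g"
  using assms by (intro coproduct_universal [OF cop]) (simp_all add: hom_def)

lemma copair_arr [simp]:
  assumes "f \<in> arr C" "g \<in> arr C" "Cod C f = Cod C g"
  shows "copair C f g \<in> arr C" "Dom C (copair C f g) = cop C (Dom C f) (Dom C g)"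
    "Cod C (copair C f g) = Cod C g"
  using theI' [OF copair_ex1 [OF assms]] assms unfolding copair_def [symmetric]
  by (simp_all add: hom_def)

lemma copair_inj [simp]:
  assumes "f \<in> arr C" "g \<in> arr C" "Cod C f = Cod C g" "Dom C f = A" "Dom C g = B"
  shows "copair C f g \<cdot> inl C A B = f" "copair C f g \<cdot> inr C A B = g"
  using theI' [OF copair_ex1 [OF assms(1-3)]] assms unfolding copair_def [symmetric]
  by (simp_all add: hom_def)

lemma copair_inj_comp [simp]:
  assumes "f \<in> arr C" "g \<in> arr C" "Cod C f = Cod C g" "Dom C f = A" "Dom C g = B" "x \<in> arr C"
  shows "Cod C x = A \<Longrightarrow> copair C f g \<cdot> (inl C A B \<cdot> x) = f \<cdot> x"
    "Cod C x = B \<Longrightarrow> copair C f g \<cdot> (inr C A B \<cdot> x) = g \<cdot> x"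
  using assms comp_eq_reassoc1 [OF copair_inj(1) [OF assms(1-5)], of x]
    comp_eq_reassoc1 [OF copair_inj(2) [OF assms(1-5)], of x]
  by auto

lemma cop_ext:
  assumes "A \<in> obj C" "B \<in> obj C" "f \<in> arr C" "g \<in> arr C" "Dom C f = cop C A B" "Dom C g = cop C A B"
    and "f \<cdot> inl C A B = g \<cdot> inl C A B" "f \<cdot> inr C A B = g \<cdot> inr C A B"
  shows "f = g"
proof -
  have cod: "Cod C f = Cod C g"
    using comp_arr(3) [of "inl C A B" f] comp_arr(3) [of "inl C A B" g] assms(1-7) by (metis inj_arr(1,3))
  have "\<exists>!h. h \<in> hom C (cop C A B) (Cod C g) \<and> h \<cdot> inl C A B = g \<cdot> inl C A B
    \<and> h \<cdot> inr C A B = g \<cdot> inr C A B"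
    by (intro coproduct_universal [OF cop [OF assms(1,2)]]) (use assms(1-6) in \<open>simp_all add: hom_def\<close>)
  then show ?thesis by (rule ex1_eqD) (use assms cod in \<open>simp_all add: hom_def\<close>)
qed

lemma comp_copair:
  assumes "f \<in> arr C" "g \<in> arr C" "h \<in> arr C" "Cod C f = Dom C h" "Cod C g = Dom C h"
  shows "h \<cdot> copair C f g = copair C (h \<cdot> f) (h \<cdot> g)"
  by (rule cop_ext [of "Dom C f" "Dom C g"]) (use assms in \<open>simp_all add: comp_assoc\<close>)

lemma copair_inl_inr [simp]:
  assumes "A \<in> obj C" "B \<in> obj C"
  shows "copair C (inl C A B) (inr C A B) = ide C (cop C A B)"
  by (rule cop_ext [of A B]) (use assms in simp_all)

section \<open>Binary products\<close>

lemma prj_arr [simp]: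
  assumes "A \<in> obj C" "B \<in> obj C"
  shows "prl C A B \<in> arr C" "Dom C (prl C A B) = prd C A B" "Cod C (prl C A B) = A"
    "prr C A B \<in> arr C" "Dom C (prr C A B) = prd C A B" "Cod C (prr C A B) = B"
  using prd [OF assms] unfolding is_product_def by (simp_all add: hom_def)

lemma product_universal:
  assumes "is_product C P p1 p2 A B" "T \<in> obj C" "f \<in> hom C T A" "g \<in> hom C T B"
  shows "\<exists>!h. h \<in> hom C T P \<and> p1 \<cdot> h = f \<and> p2 \<cdot> h = g"
  using assms by (simp only: is_product_def)

lemma pair_ex1:
  assumes "f \<in> arr C" "g \<in> arr C" "Dom C f = Dom C g"
  shows "\<exists>!h. h \<in> hom C (Dom C f) (prd C (Cod C f) (Cod C g))
    \<and> prl C (Cod C f) (Cod C g) \<cdot> h = f \<and> prr C (Cod C f) (Cod C g) \<cdot> h = g"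
  using assms by (intro product_universal [OF prd]) (simp_all add: hom_def)

lemma pair_arr [simp]:
  assumes "f \<in> arr C" "g \<in> arr C" "Dom C f = Dom C g"
  shows "pair C f g \<in> arr C" "Cod C (pair C f g) = prd C (Cod C f) (Cod C g)"
    "Dom C (pair C f g) = Dom C g"
  using theI' [OF pair_ex1 [OF assms]] assms unfolding pair_def [symmetric]
  by (simp_all add: hom_def)

lemma prj_pair [simp]:
  assumes "f \<in> arr C" "g \<in> arr C" "Dom C f = Dom C g" "Cod C f = A" "Cod C g = B"
  shows "prl C A B \<cdot> pair C f g = f" "prr C A B \<cdot> pair C f g = g"
  using theI' [OF pair_ex1 [OF assms(1-3)]] assms unfolding pair_def [symmetric]
  by (simp_all add: hom_def)

lemma pair_comp_eq_iff:
  assumes [simp]: "f \<in> arr C" "g \<in> arr C" "Dom C f = Dom C g" "f' \<in> arr C" "g' \<in> arr C" "Dom C f' = Dom C g'"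
    and [simp]: "Cod C f' = Cod C f" "Cod C g' = Cod C g" "x \<in> arr C" "y \<in> arr C" "Dom C y = Dom C x"
    and [simp]: "Cod C x = Dom C g" "Cod C y = Dom C g'"
  shows "pair C f g \<cdot> x = pair C f' g' \<cdot> y \<longleftrightarrow> f \<cdot> x = f' \<cdot> y \<and> g \<cdot> x = g' \<cdot> y"
proof -
  let ?l = "prl C (Cod C f) (Cod C g)" and ?r = "prr C (Cod C f) (Cod C g)"
  have l: "?l \<cdot> (pair C f g \<cdot> x) = f \<cdot> x" "?l \<cdot> (pair C f' g' \<cdot> y) = f' \<cdot> y"
    by (rule comp_eq_reassoc1; simp)+
  have r: "?r \<cdot> (pair C f g \<cdot> x) = g \<cdot> x" "?r \<cdot> (pair C f' g' \<cdot> y) = g' \<cdot> y"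
    by (rule comp_eq_reassoc1; simp)+
  show ?thesis
  proof
    assume "pair C f g \<cdot> x = pair C f' g' \<cdot> y"
    then show "f \<cdot> x = f' \<cdot> y \<and> g \<cdot> x = g' \<cdot> y" using l r by metis
  next
    assume *: "f \<cdot> x = f' \<cdot> y \<and> g \<cdot> x = g' \<cdot> y"
    have "\<exists>!h. h \<in> hom C (Dom C x) (prd C (Cod C f) (Cod C g)) \<and> ?l \<cdot> h = f \<cdot> x \<and> ?r \<cdot> h = g \<cdot> x"
      by (intro product_universal [OF prd]) (simp_all add: hom_def)
    then show "pair C f g \<cdot> x = pair C f' g' \<cdot> y"
      by (rule ex1_eqD) (use * in \<open>simp_all add: hom_def l r\<close>)
  qed
qed

section \<open>Existence of pullbacks and equalisers\<close>

lemma pullback_exists: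
  assumes "f \<in> arr C" "g \<in> arr C" "Cod C f = Cod C g"
  obtains P p1 p2 where "is_pullback C P p1 p2 f g"
  using barr_exact assms
  unfolding is_barr_exact_def is_regular_category_def finitely_complete_def by blast

text \<open>Realised as the pullback of the graphs of \<open>f\<close> and \<open>g\<close>: the
  first components, both identities, force the two projections to agree.\<close>

lemma equalizer_exists:
  assumes [simp]: "f \<in> arr C" "g \<in> arr C" "Dom C g = Dom C f" "Cod C g = Cod C f"
  obtains e where "monic C e" "Cod C e = Dom C f" "f \<cdot> e = g \<cdot> e"
    "\<And>x. \<lbrakk>x \<in> arr C; Cod C x = Dom C f; f \<cdot> x = g \<cdot> x\<rbrakk> \<Longrightarrow> factors_through C x e"
proof -
  let ?u = "pair C (ide C (Dom C f)) f" and ?v = "pair C (ide C (Dom C f)) g"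
  obtain P p1 p2 where pb: "is_pullback C P p1 p2 ?u ?v"
    by (rule pullback_exists [of ?u ?v]) simp_all
  note [simp] = pullbackD(4-9) [OF pb, simplified]
  have "ide C (Dom C f) \<cdot> p1 = ide C (Dom C f) \<cdot> p2 \<and> f \<cdot> p1 = g \<cdot> p2"
    by (rule iffD1 [OF pair_comp_eq_iff pullbackD(10) [OF pb]]) simp_all
  then have 12: "ide C (Dom C f) \<cdot> p1 = ide C (Dom C f) \<cdot> p2" "f \<cdot> p1 = g \<cdot> p2"
    by blast+
  have p12: "p1 = p2" using 12(1) by simp
  have "monic C ?v"
    unfolding monic_def by (auto simp: pair_comp_eq_iff)
  then have "monic C p1" using pullback_monic [OF pb] by simp
  moreover have "factors_through C x p1" if [simp]: "x \<in> arr C" "Cod C x = Dom C f" and "f \<cdot> x = g \<cdot> x" for x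
  proof -
    have "?u \<cdot> x = ?v \<cdot> x" using that by (simp add: pair_comp_eq_iff)
    then obtain h where "h \<in> arr C" "Cod C h = P" "p1 \<cdot> h = x"
      by (auto intro: pullback_factor [OF pb, of x x])
    then show ?thesis by (intro factors_throughI [of _ _ h]) simp_all
  qed
  ultimately show thesis using that [of p1] 12(2) p12 by simp
qed

section \<open>Protomodularity in terms of generating pairs\<close>

text \<open>This turns protomodularity, which speaks of pullbacks, into a statement about kernels.
  The kernel property enters through \<open>univ\<close> rather than through \<open>ker\<close>,
  because one of the uses concerns a kernel that is not the chosen one.\<close>

lemma pullback_along_zero:
  assumes Z: "is_zero_object C Z" and v: "v \<in> hom C Z B" and f [simp]: "f \<in> arr C" "Cod C f = B"
    and k: "monic C k" and [simp]: "Cod C k = Dom C f" and fk: "f \<cdot> k = zero_arr C (Dom C k) B"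
    and a: "a \<in> hom C (Dom C k) Z"
    and univ: "\<And>x. \<lbrakk>x \<in> arr C; Cod C x = Dom C f; f \<cdot> x = zero_arr C (Dom C x) B\<rbrakk>
      \<Longrightarrow> factors_through C x k"
  shows "is_pullback C (Dom C k) a k v f"
proof -
  note [simp] = monic_arr [OF k] in_homE [OF v] in_homE [OF a]
  have B [simp]: "B \<in> obj C" using Cod_in_obj [OF f(1)] by simp
  have va: "v \<cdot> b = zero_arr C (Dom C b) B" if "b \<in> arr C" "Cod C b = Z" for b
    using zero_arrI [of "Dom C b" B Z b v] Z v that by (simp add: hom_def)
  have "\<exists>!h. h \<in> hom C T (Dom C k) \<and> a \<cdot> h = b \<and> k \<cdot> h = c"
    if b: "b \<in> hom C T Z" and c: "c \<in> hom C T (Dom C f)" and eq: "v \<cdot> b = f \<cdot> c" for T b c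
  proof -
    note [simp] = in_homE [OF b] in_homE [OF c]
    have "factors_through C c k" using eq va [of b] by (intro univ) simp_all
    then obtain d where d: "d \<in> arr C" "Dom C d = Dom C c" "Cod C d = Dom C k" "c = k \<cdot> d"
      by (rule factors_throughE)
    have [simp]: "Dom C d = T" using d(2) by simp
    have "a \<cdot> d = b" by (rule zero_object_arr_unique [OF Z]) (use d in simp_all)
    then show ?thesis
      using d by (intro ex1I [of _ d]) (auto simp: hom_def intro: monicD [OF k])
  qed
  then show ?thesis
    unfolding is_pullback_def using fk va [of a] a v by (simp add: in_homI)
qed

text \<open>The restriction \<open>p \<cdot> m\<close> is again a point over \<open>B\<close>, and
  since \<open>ker C p\<close> already factors through \<open>m\<close>, both points have the same
  kernel object \<open>K\<close>. The arrow induced on kernels is therefore an identity, and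
  protomodularity makes \<open>m\<close> invertible.\<close>

lemma point_monic_iso:
  assumes pt: "is_point C B X p s" and m: "monic C m" and [simp]: "Cod C m = X"
    and s: "factors_through C s m" and k: "factors_through C (ker C p) m"
  shows "is_iso C m"
proof -
  have [simp]: "p \<in> arr C" "Dom C p = X" "Cod C p = B" "s \<in> arr C" "Dom C s = B" "Cod C s = X"
    and ps: "p \<cdot> s = ide C B"
    using pt unfolding is_point_def by (auto simp: hom_def)
  have [simp]: "m \<in> arr C" using m by (rule monic_arr)
  have X [simp]: "X \<in> obj C" using Dom_in_obj [of p] by simp
  have B [simp]: "B \<in> obj C" using Dom_in_obj [of s] by simp
  define K where "K = Dom C (ker C p)"
  have [simp]: "Dom C (ker C p) = K" by (simp add: K_def)
  have [simp]: "K \<in> obj C" using Dom_in_obj [of "ker C p"] by simp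
  obtain s1 where s1: "s1 \<in> arr C" "Dom C s1 = B" "Cod C s1 = Dom C m" "s = m \<cdot> s1"
    using factors_throughD [OF s, of B] by auto
  obtain k1 where k1: "k1 \<in> arr C" "Dom C k1 = K" "Cod C k1 = Dom C m" "ker C p = m \<cdot> k1"
    using factors_throughD [OF k, of K] by auto
  note [simp] = s1(1-3) k1(1-3)
  obtain Z a v where Z: "is_zero_object C Z" "a \<in> hom C K Z" "v \<in> hom C Z B"
    by (rule zero_arr_through [of K B]) simp_all
  have pb: "is_pullback C K a (ker C p) v p"
    using pullback_along_zero [of Z v B p "ker C p" a] Z ker_monic [of p] ker_factors [of p] by simp
  have pmk1: "(p \<cdot> m) \<cdot> k1 = zero_arr C K B"
    using ker_arr(3) [of p] by (simp add: comp_assoc k1(4) [symmetric])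
  have k1m: "monic C k1"
    unfolding monic_def
  proof (intro conjI ballI impI)
    fix x y assume [simp]: "x \<in> arr C" "y \<in> arr C"
    assume *: "Dom C x = Dom C y \<and> Cod C x = Dom C k1 \<and> Cod C y = Dom C k1 \<and> k1 \<cdot> x = k1 \<cdot> y"
    then have "ker C p \<cdot> x = ker C p \<cdot> y" by (simp add: k1(4) comp_assoc)
    then show "x = y" by (rule monicD [OF ker_monic, rotated]) (use * in simp_all)
  qed simp
  \<comment> \<open>\<open>k1\<close> is a kernel of \<open>p \<cdot> m\<close>: what
    \<open>p \<cdot> m\<close> kills is sent by \<open>m\<close> into the kernel of
    \<open>p\<close>, and \<open>m\<close> can then be cancelled.\<close>
  have "is_pullback C (Dom C k1) a k1 v (p \<cdot> m)"
  proof (rule pullback_along_zero [OF Z(1,3) _ _ k1m])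
    fix x assume [simp]: "x \<in> arr C" "Cod C x = Dom C (p \<cdot> m)" and "(p \<cdot> m) \<cdot> x = zero_arr C (Dom C x) B"
    then have fx: "factors_through C (m \<cdot> x) (ker C p)"
      by (intro ker_factors) (simp_all add: comp_assoc)
    then obtain y where y: "y \<in> arr C" "Dom C y = Dom C x" "Cod C y = K" "m \<cdot> x = ker C p \<cdot> y"
      using factors_throughD [OF fx, of "Dom C x"] by auto
    have "m \<cdot> x = m \<cdot> (k1 \<cdot> y)" using y by (simp add: k1(4) comp_assoc)
    then have "x = k1 \<cdot> y" by (rule monicD [OF m]) (use y in simp_all)
    then show "factors_through C x k1" by (rule factors_throughI) (use y in simp_all)
  qed (use Z pmk1 in simp_all)
  then have pb': "is_pullback C K a k1 v (p \<cdot> m)" by simp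
  have "is_point C B (Dom C m) (p \<cdot> m) s1"
    unfolding is_point_def using ps by (simp add: hom_def comp_assoc s1(4) [symmetric])
  moreover have "is_iso C (ide C K)"
    unfolding is_iso_def by (auto simp: hom_def intro!: bexI [of _ "ide C K"])
  moreover have "m \<cdot> s1 = s" using s1 by simp
  moreover have "m \<in> hom C (Dom C m) X" "ide C K \<in> hom C K K" "a \<cdot> ide C K = a"
    "ker C p \<cdot> ide C K = m \<cdot> k1"
    using Z by (simp_all add: hom_def k1(4) [symmetric])
  ultimately show ?thesis
    using protomodular [unfolded is_protomodular_def, rule_format,
      of v Z B "Dom C m" "p \<cdot> m" s1 X p s m K a k1 K a "ker C p" "ide C K"] pt pb pb' Z(3)
    by blast
qed

text \<open>The pullback of \<open>e\<close> along \<open>u\<close> is the inverse image of the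
  subobject \<open>e\<close>. It contains the section and the kernel of the point, hence is all of
  \<open>X\<close>, and its other projection provides the factorisation.\<close>

lemma point_factors_through:
  assumes pt: "is_point C B X p s" and e: "monic C e"
    and [simp]: "u \<in> arr C" "Dom C u = X" "Cod C u = Cod C e"
    and s: "factors_through C (u \<cdot> s) e" and k: "factors_through C (u \<cdot> ker C p) e"
  shows "factors_through C u e"
proof -
  have [simp]: "p \<in> arr C" "Dom C p = X" "Cod C p = B" "s \<in> arr C" "Dom C s = B" "Cod C s = X"
    using pt unfolding is_point_def by (auto simp: hom_def)
  have [simp]: "e \<in> arr C" using e by (rule monic_arr)
  obtain W w1 w2 where pb: "is_pullback C W w1 w2 u e" by (rule pullback_exists [of u e]) simp_all
  note [simp] = pullbackD(4-9) [OF pb, simplified]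
  have lift: "factors_through C x w1"
    if [simp]: "x \<in> arr C" "Cod C x = X" and fac: "factors_through C (u \<cdot> x) e" for x
  proof -
    obtain d where d: "d \<in> arr C" "Dom C d = Dom C x" "Cod C d = Dom C e" "u \<cdot> x = e \<cdot> d"
      using factors_throughD [OF fac, of "Dom C x"] by auto
    obtain h where "h \<in> arr C" "Cod C h = W" "w1 \<cdot> h = x"
      by (rule pullback_factor [OF pb, of x d]) (use d in simp_all)
    then show ?thesis by (intro factors_throughI [of _ _ h]) simp_all
  qed
  have "is_iso C w1"
    by (rule point_monic_iso [OF pt pullback_monic [OF pb e]])
      (use lift [of s] lift [of "ker C p"] s k in simp_all)
  then obtain i where i: "i \<in> arr C" "Dom C i = X" "Cod C i = W" "w1 \<cdot> i = ide C X"
    unfolding is_iso_def by (auto simp: hom_def)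
  have "u = (u \<cdot> w1) \<cdot> i" using i by (simp add: comp_assoc)
  also have "\<dots> = e \<cdot> (w2 \<cdot> i)" using i by (simp add: pullbackD(10) [OF pb] comp_assoc)
  finally show ?thesis by (rule factors_throughI) (use i in simp_all)
qed

section \<open>Image factorisation and local lifting\<close>

text \<open>\<open>f\<close> factors through the equaliser of \<open>g\<close> and \<open>h\<close>,
  which by extremality has a right inverse.\<close>

lemma strong_epi_epi:
  assumes f: "strong_epi C f" and [simp]: "g \<in> arr C" "h \<in> arr C" "Dom C g = Cod C f" "Dom C h = Cod C f"
    and eq: "g \<cdot> f = h \<cdot> f"
  shows "g = h"
proof -
  have [simp]: "f \<in> arr C" using f by (rule strong_epi_arr)
  have [simp]: "Cod C h = Cod C g"
    using eq comp_arr(3) [of f g] comp_arr(3) [of f h] by simp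
  obtain e where e: "monic C e" "Cod C e = Dom C g" "g \<cdot> e = h \<cdot> e"
    and univ: "\<And>x. \<lbrakk>x \<in> arr C; Cod C x = Dom C g; g \<cdot> x = h \<cdot> x\<rbrakk> \<Longrightarrow> factors_through C x e"
    by (rule equalizer_exists [of g h]) simp_all
  note [simp] = monic_arr [OF e(1)]
  have "factors_through C f e" using eq by (rule univ [rotated 2]) simp_all
  then have "factors_through C (ide C (Cod C f)) e"
    by (intro strong_epi_extremal [OF f e(1)]) (simp_all add: e(2))
  then obtain d where d: "d \<in> arr C" "Cod C d = Dom C e" "ide C (Cod C f) = e \<cdot> d"
    by (rule factors_throughE)
  have "g \<cdot> ide C (Cod C f) = h \<cdot> ide C (Cod C f)"
    unfolding d(3) by (rule comp_eq_reassoc [OF e(3)]) (use d e in simp_all)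
  then show ?thesis by simp
qed

text \<open>Pulling \<open>m\<close> back along \<open>g\<close> turns an arbitrary test square into
  a monomorphism into the codomain of \<open>f\<close>.\<close>

lemma strong_epiI_extremal:
  assumes [simp]: "f \<in> arr C"
    and ext: "\<And>n. \<lbrakk>monic C n; Cod C n = Cod C f; factors_through C f n\<rbrakk>
      \<Longrightarrow> factors_through C (ide C (Cod C f)) n"
  shows "strong_epi C f"
  unfolding strong_epi_def
proof (intro conjI allI impI)
  fix m g
  assume *: "monic C m \<and> g \<in> arr C \<and> Dom C g = Cod C f \<and> Cod C g = Cod C m
    \<and> factors_through C (g \<cdot> f) m"
  then have m: "monic C m" and [simp]: "m \<in> arr C" "g \<in> arr C" "Dom C g = Cod C f" "Cod C g = Cod C m"
    and gf: "factors_through C (g \<cdot> f) m"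
    using monic_arr by auto
  obtain W w1 w2 where pb: "is_pullback C W w1 w2 g m" by (rule pullback_exists [of g m]) simp_all
  note [simp] = pullbackD(4-9) [OF pb, simplified]
  obtain d where d: "d \<in> arr C" "Dom C d = Dom C f" "Cod C d = Dom C m" "g \<cdot> f = m \<cdot> d"
    using factors_throughD [OF gf, of "Dom C f"] by auto
  obtain c where "c \<in> arr C" "Cod C c = W" "w1 \<cdot> c = f"
    by (rule pullback_factor [OF pb, of f d]) (use d in simp_all)
  then have "factors_through C f w1" by (intro factors_throughI [of _ _ c]) simp_all
  then have "factors_through C (ide C (Cod C f)) w1"
    by (intro ext pullback_monic [OF pb m]) simp_all
  then obtain i where i: "i \<in> arr C" "Cod C i = Dom C w1" "ide C (Cod C f) = w1 \<cdot> i"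
    by (rule factors_throughE)
  have "g = g \<cdot> (w1 \<cdot> i)" by (simp add: i(3) [symmetric])
  also have "\<dots> = m \<cdot> (w2 \<cdot> i)"
    by (rule comp_eq_reassoc [OF pullbackD(10) [OF pb]]) (use i in simp_all)
  finally have "g = m \<cdot> (w2 \<cdot> i)" .
  then show "factors_through C g m" by (intro factors_throughI [of _ _ "w2 \<cdot> i"]) (use i in simp_all)
qed simp

lemma regular_epi_strong_epi: "regular_epi C q \<Longrightarrow> strong_epi C q"
  unfolding regular_epi_def using coequalizer_strong_epi by blast

text \<open>Pullback stability read with generalised elements: an element \<open>a\<close> of the
  codomain of \<open>q\<close> acquires a preimage once its domain is covered by some
  \<open>t\<close>.\<close>

lemma regular_epi_lift:
  assumes q: "regular_epi C q" and [simp]: "a \<in> arr C" "Cod C a = Cod C q"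
  obtains t a' where "strong_epi C t" "Cod C t = Dom C a" "a' \<in> arr C" "Dom C a' = Dom C t"
    "Cod C a' = Dom C q" "q \<cdot> a' = a \<cdot> t"
proof -
  have [simp]: "q \<in> arr C" using q regular_epi_strong_epi strong_epi_arr by blast
  obtain P p1 p2 where pb: "is_pullback C P p1 p2 q a" by (rule pullback_exists [of q a]) simp_all
  have "is_regular_category C" using barr_exact unfolding is_barr_exact_def by (rule conjunct1)
  then have "regular_epi C p2" using pb q unfolding is_regular_category_def by blast
  then show thesis using that [of p2 p1] pullbackD [OF pb] regular_epi_strong_epi by simp
qed

text \<open>The first factor \<open>q\<close> is the coequaliser of the kernel pair of
  \<open>f\<close>. To see that the second is monic, two elements with equal images are lifted
  locally along \<open>q\<close>; the lifts have equal images under \<open>f\<close>, so they form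
  an element of the kernel pair and \<open>q\<close> identifies them.\<close>

lemma image_factorisation:
  assumes [simp]: "f \<in> arr C"
  obtains m q where "monic C m" "regular_epi C q" "Cod C q = Dom C m" "Dom C q = Dom C f"
    "Cod C m = Cod C f" "f = m \<cdot> q"
proof -
  obtain P p1 p2 where pb: "is_pullback C P p1 p2 f f" by (rule pullback_exists [of f f]) simp_all
  note [simp] = pullbackD(4-9) [OF pb, simplified]
  have "is_regular_category C" using barr_exact unfolding is_barr_exact_def by (rule conjunct1)
  then obtain q where co: "is_coequalizer C q p1 p2"
    using pb unfolding is_regular_category_def by blast
  then have q: "regular_epi C q" unfolding regular_epi_def by blast
  have [simp]: "q \<in> arr C" "Dom C q = Dom C f" and qp: "q \<cdot> p1 = q \<cdot> p2"
    using co unfolding is_coequalizer_def by (auto simp: hom_def)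
  obtain m where m [simp]: "m \<in> arr C" "Dom C m = Cod C q" "Cod C m = Cod C f" and f: "m \<cdot> q = f"
    by (rule coequalizer_factor [OF co, of f]) (simp_all add: pullbackD(10) [OF pb])
  have "monic C m"
    unfolding monic_def
  proof (intro conjI ballI impI)
    fix a b assume [simp]: "a \<in> arr C" "b \<in> arr C"
    assume *: "Dom C a = Dom C b \<and> Cod C a = Dom C m \<and> Cod C b = Dom C m \<and> m \<cdot> a = m \<cdot> b"
    then have [simp]: "Dom C a = Dom C b" "Cod C a = Cod C q" "Cod C b = Cod C q" by simp_all
    have mab: "m \<cdot> a = m \<cdot> b" using * by blast
    obtain s a' where s: "strong_epi C s" and [simp]: "Cod C s = Dom C b" "a' \<in> arr C"
      "Dom C a' = Dom C s" "Cod C a' = Dom C f" and qa: "q \<cdot> a' = a \<cdot> s"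
      by (rule regular_epi_lift [OF q, of a]) simp_all
    note [simp] = strong_epi_arr [OF s]
    \<comment> \<open>The second lift starts on the cover \<open>s\<close> of the first one, so that
      after \<open>t\<close> both lifts live on a common domain.\<close>
    obtain t b' where t: "strong_epi C t" and [simp]: "Cod C t = Dom C s" "b' \<in> arr C"
      "Dom C b' = Dom C t" "Cod C b' = Dom C f" and qb: "q \<cdot> b' = (b \<cdot> s) \<cdot> t"
      by (rule regular_epi_lift [OF q, of "b \<cdot> s"]) simp_all
    note [simp] = strong_epi_arr [OF t]
    note mq = comp_eq_reassoc1 [OF f]
    have "f \<cdot> (a' \<cdot> t) = m \<cdot> ((q \<cdot> a') \<cdot> t)" by (simp add: mq comp_assoc)
    also have "\<dots> = (m \<cdot> a) \<cdot> (s \<cdot> t)" by (simp add: qa comp_assoc)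
    also have "\<dots> = m \<cdot> (q \<cdot> b')" by (simp add: qb mab comp_assoc)
    also have "\<dots> = f \<cdot> b'" by (simp add: mq)
    finally have eq: "f \<cdot> (a' \<cdot> t) = f \<cdot> b'" .
    obtain c where c: "c \<in> arr C" "Cod C c = P" "p1 \<cdot> c = a' \<cdot> t" "p2 \<cdot> c = b'"
      by (rule pullback_factor [OF pb, of "a' \<cdot> t" b']) (use eq in simp_all)
    have "q \<cdot> (p1 \<cdot> c) = q \<cdot> (p2 \<cdot> c)" by (rule comp_eq_reassoc [OF qp]) (use c(1,2) in simp_all)
    then have "(q \<cdot> a') \<cdot> t = q \<cdot> b'" using c by (simp add: comp_assoc)
    then have "a \<cdot> (s \<cdot> t) = b \<cdot> (s \<cdot> t)" by (simp add: qa qb comp_assoc)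
    then show "a = b" by (rule strong_epi_epi [OF strong_epi_comp [OF t s], rotated 5]) simp_all
  qed simp
  then show thesis by (rule that [OF _ q]) (simp_all add: f)
qed

text \<open>The monomorphism in the image factorisation of a strong epimorphism has a right inverse
  \<open>d\<close>. Lifting \<open>d \<cdot> a\<close> along the regular part therefore lifts
  \<open>a\<close> along \<open>f\<close>.\<close>

lemma strong_epi_lift:
  assumes f: "strong_epi C f" and [simp]: "a \<in> arr C" "Cod C a = Cod C f"
  obtains t a' where "strong_epi C t" "Cod C t = Dom C a" "a' \<in> arr C" "Dom C a' = Dom C t"
    "Cod C a' = Dom C f" "f \<cdot> a' = a \<cdot> t"
proof -
  have [simp]: "f \<in> arr C" using f by (rule strong_epi_arr)
  obtain m q where m: "monic C m" and q: "regular_epi C q" and [simp]: "Cod C q = Dom C m"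
    "Dom C q = Dom C f" "Cod C m = Cod C f" and fmq: "f = m \<cdot> q"
    by (rule image_factorisation [of f]) simp_all
  note [simp] = monic_arr [OF m] strong_epi_arr [OF regular_epi_strong_epi [OF q]]
  have "factors_through C f m" by (rule factors_throughI [OF fmq]) simp_all
  then have "factors_through C (ide C (Cod C f)) m" by (intro strong_epi_extremal [OF f m]) simp_all
  then obtain d where d: "d \<in> arr C" "Dom C d = Dom C (ide C (Cod C f))" "Cod C d = Dom C m"
    "ide C (Cod C f) = m \<cdot> d"
    by (rule factors_throughE)
  have [simp]: "d \<in> arr C" "Dom C d = Cod C f" "Cod C d = Dom C m" using d(1-3) by simp_all
  obtain t a' where t: "strong_epi C t" and [simp]: "Cod C t = Dom C a" "a' \<in> arr C"
    "Dom C a' = Dom C t" "Cod C a' = Dom C f" and qa: "q \<cdot> a' = (d \<cdot> a) \<cdot> t"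
    by (rule regular_epi_lift [OF q, of "d \<cdot> a"]) simp_all
  note [simp] = strong_epi_arr [OF t]
  have "f \<cdot> a' = m \<cdot> (q \<cdot> a')" by (simp add: comp_eq_reassoc1 [OF fmq [symmetric]])
  also have "\<dots> = (m \<cdot> d) \<cdot> (a \<cdot> t)" by (simp add: qa comp_assoc)
  also have "\<dots> = a \<cdot> t" by (simp add: d(4) [symmetric])
  finally show thesis using that [of t a'] t by simp
qed

section \<open>The functor \<open>\<flat>\<close>\<close>

abbreviation retract :: "'o \<Rightarrow> 'o \<Rightarrow> 'm" where
  "retract A B \<equiv> copair C (ide C A) (zero_arr C B A)"

lemma copair_zero [simp]:
  assumes "A \<in> obj C" "B \<in> obj C" "D \<in> obj C"
  shows "copair C (zero_arr C A D) (zero_arr C B D) = zero_arr C (cop C A B) D"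
  by (rule cop_ext [of A B]) (use assms in simp_all)

lemma factor_eq:
  assumes k: "monic C k" and f: "factors_through C f k"
  shows "factor C k f \<in> arr C" "Dom C (factor C k f) = Dom C f" "Cod C (factor C k f) = Dom C k"
    "k \<cdot> factor C k f = f"
proof -
  note [simp] = monic_arr [OF k]
  obtain d where d: "d \<in> arr C" "Dom C d = Dom C f" "Cod C d = Dom C k" "f = k \<cdot> d"
    using f by (rule factors_throughE)
  have "\<exists>!u. u \<in> hom C (Dom C f) (Dom C k) \<and> k \<cdot> u = f"
  proof (rule ex1I [of _ d])
    show "d \<in> hom C (Dom C f) (Dom C k) \<and> k \<cdot> d = f"
      using d(1-3) by (simp add: hom_def d(4) [symmetric])
    fix u assume u: "u \<in> hom C (Dom C f) (Dom C k) \<and> k \<cdot> u = f"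
    then have "k \<cdot> u = k \<cdot> d" using d(4) by simp
    then show "u = d" by (rule monicD [OF k]) (use u d(1-3) in \<open>auto simp: hom_def\<close>)
  qed
  from theI' [OF this, folded factor_def]
  show "factor C k f \<in> arr C" "Dom C (factor C k f) = Dom C f" "Cod C (factor C k f) = Dom C k"
    "k \<cdot> factor C k f = f"
    by (auto simp: hom_def)
qed

section \<open>Functoriality of the coproduct\<close>

lemma cop_map_arr [simp]:
  assumes "f \<in> arr C" "g \<in> arr C"
  shows "f \<oplus> g \<in> arr C" "Dom C (f \<oplus> g) = cop C (Dom C f) (Dom C g)"
    "Cod C (f \<oplus> g) = cop C (Cod C f) (Cod C g)"
  unfolding cop_map_def using assms by simp_all

lemma copair_cop_map:
  assumes "f \<in> arr C" "g \<in> arr C" "u \<in> arr C" "v \<in> arr C" "Cod C u = Cod C v"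
    and "Cod C f = Dom C u" "Cod C g = Dom C v"
  shows "copair C u v \<cdot> (f \<oplus> g) = copair C (u \<cdot> f) (v \<cdot> g)"
  unfolding cop_map_def using assms by (simp add: comp_copair)

lemma cop_map_inj:
  assumes "f \<in> arr C" "g \<in> arr C" "Dom C f = A" "Dom C g = B"
  shows "(f \<oplus> g) \<cdot> inl C A B = inl C (Cod C f) (Cod C g) \<cdot> f"
    "(f \<oplus> g) \<cdot> inr C A B = inr C (Cod C f) (Cod C g) \<cdot> g"
  unfolding cop_map_def using assms by simp_all

lemma cop_map_comp:
  assumes "f \<in> arr C" "g \<in> arr C" "f' \<in> arr C" "g' \<in> arr C"
    and "Cod C f' = Dom C f" "Cod C g' = Dom C g"
  shows "(f \<oplus> g) \<cdot> (f' \<oplus> g') = (f \<cdot> f') \<oplus> (g \<cdot> g')"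
  unfolding cop_map_def [of _ f g] cop_map_def [of _ "f \<cdot> f'"]
  using assms by (simp add: copair_cop_map comp_assoc)

lemma cop_map_ide [simp]:
  assumes "A \<in> obj C" "B \<in> obj C"
  shows "ide C A \<oplus> ide C B = ide C (cop C A B)"
  unfolding cop_map_def using assms by simp

section \<open>Kernel inclusions and functoriality of \<open>\<flat>\<close>\<close>

lemma kflat_arr [simp]:
  assumes "A \<in> obj C" "B \<in> obj C"
  shows "kflat C A B \<in> arr C" "Dom C (kflat C A B) = flat_obj C A B" "Cod C (kflat C A B) = cop C A B"
    "flat_obj C A B \<in> obj C"
  unfolding flat_obj_def kflat_def using assms by simp_all

lemma retract_kflat:
  assumes "A \<in> obj C" "B \<in> obj C"
  shows "retract A B \<cdot> kflat C A B = zero_arr C (flat_obj C A B) A"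
  unfolding flat_obj_def kflat_def using assms by simp

lemma kflat_monic:
  assumes "A \<in> obj C" "B \<in> obj C"
  shows "monic C (kflat C A B)"
  unfolding kflat_def using assms by (simp add: ker_monic)

lemma kflat_factors:
  assumes "A \<in> obj C" "B \<in> obj C" "x \<in> arr C" "Cod C x = cop C A B"
    and "retract A B \<cdot> x = zero_arr C (Dom C x) A"
  shows "factors_through C x (kflat C A B)"
  unfolding kflat_def by (rule ker_factors) (use assms in simp_all)

lemma flat_ext:
  assumes "kflat C A B \<cdot> x = kflat C A B \<cdot> y" "A \<in> obj C" "B \<in> obj C" "x \<in> arr C" "y \<in> arr C"
    and "Cod C x = flat_obj C A B" "Cod C y = flat_obj C A B"
  shows "x = y"
  using assms(1) by (rule monicD [OF kflat_monic, rotated 2]) (use assms in simp_all)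

lemma flat_map_factors:
  assumes [simp]: "f \<in> arr C" "g \<in> arr C"
  shows "factors_through C ((f \<oplus> g) \<cdot> kflat C (Dom C f) (Dom C g)) (kflat C (Cod C f) (Cod C g))"
proof (rule kflat_factors)
  let ?A = "Dom C f" and ?B = "Dom C g"
  have "retract (Cod C f) (Cod C g) \<cdot> (f \<oplus> g) = f \<cdot> retract ?A ?B"
    by (simp add: copair_cop_map comp_copair)
  then have "retract (Cod C f) (Cod C g) \<cdot> ((f \<oplus> g) \<cdot> kflat C ?A ?B) = f \<cdot> (retract ?A ?B \<cdot> kflat C ?A ?B)"
    by (rule comp_eq_reassoc) simp_all
  then show "retract (Cod C f) (Cod C g) \<cdot> ((f \<oplus> g) \<cdot> kflat C ?A ?B)
      = zero_arr C (Dom C ((f \<oplus> g) \<cdot> kflat C ?A ?B)) (Cod C f)"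
    by (simp add: retract_kflat)
qed simp_all

lemma flat_map_arr [simp]:
  assumes "f \<in> arr C" "g \<in> arr C"
  shows "f \<flat> g \<in> arr C" "Dom C (f \<flat> g) = flat_obj C (Dom C f) (Dom C g)"
    "Cod C (f \<flat> g) = flat_obj C (Cod C f) (Cod C g)"
  unfolding flat_map_def
  using factor_eq [OF kflat_monic flat_map_factors, of f g] assms by simp_all

lemma kflat_flat_map:
  assumes "f \<in> arr C" "g \<in> arr C" "Cod C f = A" "Cod C g = B"
  shows "kflat C A B \<cdot> (f \<flat> g) = (f \<oplus> g) \<cdot> kflat C (Dom C f) (Dom C g)"
  unfolding flat_map_def
  using factor_eq(4) [OF kflat_monic flat_map_factors, of f g] assms by auto

lemma kflat_flat_map_comp:
  assumes "f \<in> arr C" "g \<in> arr C" "Cod C f = A" "Cod C g = B"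
    and "x \<in> arr C" "Cod C x = flat_obj C (Dom C f) (Dom C g)"
  shows "kflat C A B \<cdot> ((f \<flat> g) \<cdot> x) = (f \<oplus> g) \<cdot> (kflat C (Dom C f) (Dom C g) \<cdot> x)"
  by (rule comp_eq_reassoc [OF kflat_flat_map]) (use assms in auto)

lemma flat_map_comp:
  assumes "f \<in> arr C" "g \<in> arr C" "f' \<in> arr C" "g' \<in> arr C"
    and "Cod C f' = Dom C f" "Cod C g' = Dom C g"
  shows "(f \<flat> g) \<cdot> (f' \<flat> g') = (f \<cdot> f') \<flat> (g \<cdot> g')"
  by (rule flat_ext [of "Cod C f" "Cod C g"])
    (use assms in \<open>simp_all add: kflat_flat_map_comp kflat_flat_map cop_map_comp [symmetric] comp_assoc\<close>)

lemma flat_map_ide [simp]: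
  assumes "A \<in> obj C" "B \<in> obj C"
  shows "ide C A \<flat> ide C B = ide C (flat_obj C A B)"
  by (rule flat_ext [of A B]) (use assms in \<open>simp_all add: kflat_flat_map\<close>)

section \<open>Unit and multiplication of the monad\<close>

lemma flat_unit_eq [simp]:
  assumes "A \<in> obj C" "B \<in> obj C"
  shows "flat_unit C A B \<in> arr C" "Dom C (flat_unit C A B) = B" "Cod C (flat_unit C A B) = flat_obj C A B"
    "kflat C A B \<cdot> flat_unit C A B = inr C A B"
proof -
  have "factors_through C (inr C A B) (kflat C A B)"
    by (rule kflat_factors) (use assms in simp_all)
  from factor_eq [OF kflat_monic [OF assms] this, folded flat_unit_def] assms
  show "flat_unit C A B \<in> arr C" "Dom C (flat_unit C A B) = B" "Cod C (flat_unit C A B) = flat_obj C A B"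
    "kflat C A B \<cdot> flat_unit C A B = inr C A B"
    by simp_all
qed

lemma flat_mult_eq [simp]:
  assumes [simp]: "A \<in> obj C" "B \<in> obj C"
  shows "flat_mult C A B \<in> arr C" "Dom C (flat_mult C A B) = flat_obj C A (flat_obj C A B)"
    "Cod C (flat_mult C A B) = flat_obj C A B"
    "kflat C A B \<cdot> flat_mult C A B = copair C (inl C A B) (kflat C A B) \<cdot> kflat C A (flat_obj C A B)"
proof -
  have "retract A B \<cdot> copair C (inl C A B) (kflat C A B) = retract A (flat_obj C A B)"
    by (simp add: comp_copair retract_kflat)
  then have "retract A B \<cdot> (copair C (inl C A B) (kflat C A B) \<cdot> kflat C A (flat_obj C A B))
      = retract A (flat_obj C A B) \<cdot> kflat C A (flat_obj C A B)"
    by (rule comp_eq_reassoc1) simp_all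
  then have "factors_through C (copair C (inl C A B) (kflat C A B) \<cdot> kflat C A (flat_obj C A B)) (kflat C A B)"
    by (intro kflat_factors) (simp_all add: retract_kflat)
  from factor_eq [OF kflat_monic [OF assms] this, folded flat_mult_def]
  show "flat_mult C A B \<in> arr C" "Dom C (flat_mult C A B) = flat_obj C A (flat_obj C A B)"
    "Cod C (flat_mult C A B) = flat_obj C A B"
    "kflat C A B \<cdot> flat_mult C A B = copair C (inl C A B) (kflat C A B) \<cdot> kflat C A (flat_obj C A B)"
    by simp_all
qed

lemma flat_unit_natural:
  assumes "f \<in> arr C" "g \<in> arr C"
  shows "(f \<flat> g) \<cdot> flat_unit C (Dom C f) (Dom C g) = flat_unit C (Cod C f) (Cod C g) \<cdot> g"
proof (rule flat_ext [of "Cod C f" "Cod C g"])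
  have "kflat C (Cod C f) (Cod C g) \<cdot> (flat_unit C (Cod C f) (Cod C g) \<cdot> g) = inr C (Cod C f) (Cod C g) \<cdot> g"
    by (rule comp_eq_reassoc1) (use assms in simp_all)
  then show "kflat C (Cod C f) (Cod C g) \<cdot> ((f \<flat> g) \<cdot> flat_unit C (Dom C f) (Dom C g))
      = kflat C (Cod C f) (Cod C g) \<cdot> (flat_unit C (Cod C f) (Cod C g) \<cdot> g)"
    using assms by (simp add: kflat_flat_map_comp cop_map_inj)
qed (use assms in simp_all)

lemma flat_mult_natural:
  assumes [simp]: "f \<in> arr C" "g \<in> arr C"
  shows "(f \<flat> g) \<cdot> flat_mult C (Dom C f) (Dom C g)
    = flat_mult C (Cod C f) (Cod C g) \<cdot> (f \<flat> (f \<flat> g))"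
proof (rule flat_ext [of "Cod C f" "Cod C g"])
  let ?A = "Dom C f" and ?B = "Dom C g" and ?A' = "Cod C f" and ?B' = "Cod C g"
  let ?k = "kflat C ?A ?B" and ?k' = "kflat C ?A' ?B'"
    and ?K = "kflat C ?A (flat_obj C ?A ?B)" and ?K' = "kflat C ?A' (flat_obj C ?A' ?B')"
  have "?k' \<cdot> ((f \<flat> g) \<cdot> flat_mult C ?A ?B) = ((f \<oplus> g) \<cdot> copair C (inl C ?A ?B) ?k) \<cdot> ?K"
    by (simp add: kflat_flat_map_comp comp_assoc)
  also have "(f \<oplus> g) \<cdot> copair C (inl C ?A ?B) ?k = copair C (inl C ?A' ?B') ?k' \<cdot> (f \<oplus> (f \<flat> g))"
    by (simp add: comp_copair copair_cop_map cop_map_inj kflat_flat_map)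
  also have "\<dots> \<cdot> ?K = copair C (inl C ?A' ?B') ?k' \<cdot> (?K' \<cdot> (f \<flat> (f \<flat> g)))"
    by (simp add: comp_assoc kflat_flat_map)
  also have "\<dots> = ?k' \<cdot> (flat_mult C ?A' ?B' \<cdot> (f \<flat> (f \<flat> g)))"
    by (rule comp_eq_reassoc [OF flat_mult_eq(4) [symmetric]]) simp_all
  finally show "?k' \<cdot> ((f \<flat> g) \<cdot> flat_mult C ?A ?B)
      = ?k' \<cdot> (flat_mult C ?A' ?B' \<cdot> (f \<flat> (f \<flat> g)))" .
qed simp_all

section \<open>Preservation of strong epimorphisms\<close>

lemma cop_map_strong_epi:
  assumes f: "strong_epi C f" and g: "strong_epi C g"
  shows "strong_epi C (f \<oplus> g)"
  unfolding strong_epi_def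
proof (intro conjI allI impI)
  note [simp] = strong_epi_arr [OF f] strong_epi_arr [OF g]
  show "f \<oplus> g \<in> arr C" by simp
  let ?l = "inl C (Cod C f) (Cod C g)" and ?r = "inr C (Cod C f) (Cod C g)"
  fix m h
  assume *: "monic C m \<and> h \<in> arr C \<and> Dom C h = Cod C (f \<oplus> g) \<and> Cod C h = Cod C m
    \<and> factors_through C (h \<cdot> (f \<oplus> g)) m"
  then have m: "monic C m" and [simp]: "m \<in> arr C" "h \<in> arr C" "Dom C h = cop C (Cod C f) (Cod C g)"
    "Cod C h = Cod C m" and fac: "factors_through C (h \<cdot> (f \<oplus> g)) m"
    using monic_arr by auto
  have "factors_through C ((h \<cdot> (f \<oplus> g)) \<cdot> inl C (Dom C f) (Dom C g)) m"
    using fac by (rule factors_through_comp) simp_all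
  then have "factors_through C ((h \<cdot> ?l) \<cdot> f) m" by (simp add: comp_assoc cop_map_inj)
  then have "factors_through C (h \<cdot> ?l) m" by (rule strong_epiD [OF f m, rotated -1]) simp_all
  then obtain a where a: "a \<in> arr C" "Dom C a = Dom C (h \<cdot> ?l)" "Cod C a = Dom C m" "h \<cdot> ?l = m \<cdot> a"
    by (rule factors_throughE)
  have "factors_through C ((h \<cdot> (f \<oplus> g)) \<cdot> inr C (Dom C f) (Dom C g)) m"
    using fac by (rule factors_through_comp) simp_all
  then have "factors_through C ((h \<cdot> ?r) \<cdot> g) m" by (simp add: comp_assoc cop_map_inj)
  then have "factors_through C (h \<cdot> ?r) m" by (rule strong_epiD [OF g m, rotated -1]) simp_all
  then obtain b where b: "b \<in> arr C" "Dom C b = Dom C (h \<cdot> ?r)" "Cod C b = Dom C m" "h \<cdot> ?r = m \<cdot> b"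
    by (rule factors_throughE)
  have ab: "Dom C a = Cod C f" "Dom C b = Cod C g" using a(2) b(2) by simp_all
  have "h = m \<cdot> copair C a b"
    by (rule cop_ext [of "Cod C f" "Cod C g"]) (use a(1,3,4) b(1,3,4) ab in \<open>simp_all add: comp_assoc\<close>)
  then show "factors_through C h m"
    by (rule factors_throughI) (use a(1,3) b(1,3) in simp_all)
qed

text \<open>Lift an element of \<open>A' \<flat> B'\<close> locally to an element \<open>x\<close> of \<open>A + B\<close>. Its component in \<open>A\<close> lies in
  the kernel of \<open>f\<close>; protomodularity applied to the point \<open>D \<rightarrow> ker f\<close>, with \<open>D\<close> the kernel of
  \<open>A + B \<rightarrow> A \<rightarrow> A'\<close>, plays the role of dividing \<open>x\<close> by this component.\<close>

lemma flat_map_strong_epi: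
  assumes f: "strong_epi C f" and g: "strong_epi C g"
  shows "strong_epi C (f \<flat> g)"
proof (rule strong_epiI_extremal)
  note [simp] = strong_epi_arr [OF f] strong_epi_arr [OF g]
  let ?A = "Dom C f" and ?B = "Dom C g" and ?A' = "Cod C f" and ?B' = "Cod C g"
  let ?k = "kflat C ?A ?B" and ?k' = "kflat C ?A' ?B'" and ?p = "retract ?A ?B"
    and ?p' = "retract ?A' ?B'" and ?h = "f \<oplus> g" and ?s = "inl C ?A ?B"
  show "f \<flat> g \<in> arr C" by simp
  fix n
  assume n: "monic C n" and nc: "Cod C n = Cod C (f \<flat> g)" and fac: "factors_through C (f \<flat> g) n"
  note [simp] = monic_arr [OF n]
  have [simp]: "Cod C n = flat_obj C ?A' ?B'" using nc by simp
  obtain w where w: "w \<in> arr C" "Dom C w = flat_obj C ?A ?B" "Cod C w = Dom C n" "f \<flat> g = n \<cdot> w"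
    using factors_throughD [OF fac, of "flat_obj C ?A ?B"] by auto
  \<comment> \<open>The subobject \<open>n\<close> is moved from \<open>A' \<flat> B'\<close> into
    \<open>A' + B'\<close>, since the elements of \<open>D\<close> tested below need not lie in
    \<open>A \<flat> B\<close>.\<close>
  define e where "e = ?k' \<cdot> n"
  have [simp]: "e \<in> arr C" "Dom C e = Dom C n" "Cod C e = cop C ?A' ?B'" by (simp_all add: e_def)
  have e: "monic C e"
    unfolding monic_def
  proof (intro conjI ballI impI)
    fix x y assume [simp]: "x \<in> arr C" "y \<in> arr C"
    assume *: "Dom C x = Dom C y \<and> Cod C x = Dom C e \<and> Cod C y = Dom C e \<and> e \<cdot> x = e \<cdot> y"
    then have [simp]: "Cod C x = Dom C n" "Cod C y = Dom C n" by simp_all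
    have "e \<cdot> x = e \<cdot> y" using * by blast
    then have "?k' \<cdot> (n \<cdot> x) = ?k' \<cdot> (n \<cdot> y)" by (simp add: e_def comp_assoc)
    then have "n \<cdot> x = n \<cdot> y" by (rule flat_ext) simp_all
    then show "x = y" by (rule monicD [OF n]) simp_all
  qed simp
  have p'h: "?p' \<cdot> ?h = f \<cdot> ?p" by (simp add: copair_cop_map comp_copair)
  \<comment> \<open>The element lifted is the generic one, the inclusion of
    \<open>A' \<flat> B'\<close> itself.\<close>
  obtain t x where t: "strong_epi C t" and [simp]: "Cod C t = flat_obj C ?A' ?B'" "x \<in> arr C"
    "Dom C x = Dom C t" "Cod C x = cop C ?A ?B" and hx: "?h \<cdot> x = ?k' \<cdot> t"
    by (rule strong_epi_lift [OF cop_map_strong_epi [OF f g], of ?k']) simp_all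
  note [simp] = strong_epi_arr [OF t]
  define d where "d = ker C (f \<cdot> ?p)"
  have [simp]: "d \<in> arr C" "Cod C d = cop C ?A ?B" by (simp_all add: d_def)
  have fpd: "f \<cdot> (?p \<cdot> d) = zero_arr C (Dom C d) ?A'"
    using ker_arr(3) [of "f \<cdot> ?p"] by (simp add: d_def [symmetric] comp_assoc)
  define v where "v = ker C f"
  have [simp]: "v \<in> arr C" "Cod C v = ?A" and fv: "f \<cdot> v = zero_arr C (Dom C v) ?A'"
    by (simp_all add: v_def)
  have "factors_through C (?p \<cdot> d) v"
    unfolding v_def using fpd by (intro ker_factors) simp_all
  from factors_throughD [OF this, of "Dom C d"]
  obtain r where [simp]: "r \<in> arr C" "Dom C r = Dom C d" "Cod C r = Dom C v" and r: "?p \<cdot> d = v \<cdot> r"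
    by auto
  have "factors_through C (?s \<cdot> v) d"
    unfolding d_def by (rule ker_factors) (simp_all add: comp_assoc fv)
  from factors_throughD [OF this, of "Dom C v"]
  obtain c where [simp]: "c \<in> arr C" "Dom C c = Dom C v" "Cod C c = Dom C d" and c: "?s \<cdot> v = d \<cdot> c"
    by auto
  have "v \<cdot> (r \<cdot> c) = ?p \<cdot> (d \<cdot> c)" by (rule comp_eq_reassoc [OF r [symmetric]]) simp_all
  also have "\<dots> = v \<cdot> ide C (Dom C v)" by (simp add: c [symmetric])
  finally have "r \<cdot> c = ide C (Dom C v)"
    by (rule monicD [OF ker_monic [of f, folded v_def], rotated]) simp_all
  then have pt: "is_point C (Dom C v) (Dom C d) r c"
    unfolding is_point_def by (simp add: hom_def)
  \<comment> \<open>On the section \<open>c\<close> the image under \<open>f + g\<close> is zero,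
    because \<open>f\<close> kills its kernel. An element killed by \<open>r\<close> has zero
    component in \<open>A\<close>, so it lies in \<open>A \<flat> B\<close>, where
    \<open>f \<flat> g\<close> factors through \<open>n\<close> by assumption.\<close>
  have u: "factors_through C (?h \<cdot> d) e"
  proof (rule point_factors_through [OF pt e])
    have "(?h \<cdot> d) \<cdot> c = ?h \<cdot> (?s \<cdot> v)" by (simp add: comp_assoc c)
    also have "\<dots> = inl C ?A' ?B' \<cdot> (f \<cdot> v)"
      by (rule comp_eq_reassoc) (simp_all add: cop_map_inj)
    also have "\<dots> = e \<cdot> zero_arr C (Dom C v) (Dom C n)" by (simp add: fv)
    finally show "factors_through C ((?h \<cdot> d) \<cdot> c) e" by (rule factors_throughI) simp_all
    have "?p \<cdot> (d \<cdot> ker C r) = v \<cdot> (r \<cdot> ker C r)" by (rule comp_eq_reassoc [OF r]) simp_all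
    then have "factors_through C (d \<cdot> ker C r) ?k" by (intro kflat_factors) simp_all
    from factors_throughD [OF this, of "Dom C (ker C r)"]
    obtain y where [simp]: "y \<in> arr C" "Dom C y = Dom C (ker C r)" "Cod C y = flat_obj C ?A ?B"
      and y: "d \<cdot> ker C r = ?k \<cdot> y"
      by auto
    have "(?h \<cdot> d) \<cdot> ker C r = ?k' \<cdot> ((f \<flat> g) \<cdot> y)" by (simp add: comp_assoc y kflat_flat_map_comp)
    also have "\<dots> = e \<cdot> (w \<cdot> y)" using w(1-3) by (simp add: e_def comp_assoc w(4))
    finally show "factors_through C ((?h \<cdot> d) \<cdot> ker C r) e"
      by (rule factors_throughI) (use w(1-3) in simp_all)
  qed simp_all
  from factors_throughD [OF this, of "Dom C d"]
  obtain a where [simp]: "a \<in> arr C" "Dom C a = Dom C d" "Cod C a = Dom C n" and a: "?h \<cdot> d = e \<cdot> a"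
    by auto
  \<comment> \<open>The lift \<open>x\<close> lies in \<open>D\<close>, because its image in
    \<open>A' + B'\<close> comes from \<open>A' \<flat> B'\<close> and so has zero component in
    \<open>A'\<close>.\<close>
  have "f \<cdot> (?p \<cdot> x) = ?p' \<cdot> (?h \<cdot> x)" by (rule comp_eq_reassoc [OF p'h [symmetric]]) simp_all
  also have "\<dots> = zero_arr C (Dom C t) ?A'"
    unfolding hx using comp_eq_reassoc1 [OF retract_kflat, of ?A' ?B' t] by simp
  finally have "factors_through C x d" unfolding d_def by (intro ker_factors) (simp_all add: comp_assoc)
  from factors_throughD [OF this, of "Dom C t"]
  obtain z where [simp]: "z \<in> arr C" "Dom C z = Dom C t" "Cod C z = Dom C d" and z: "x = d \<cdot> z"
    by auto
  have "?k' \<cdot> t = ?h \<cdot> (d \<cdot> z)" unfolding z [symmetric] hx ..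
  also have "\<dots> = e \<cdot> (a \<cdot> z)" by (rule comp_eq_reassoc [OF a]) simp_all
  also have "\<dots> = ?k' \<cdot> (n \<cdot> (a \<cdot> z))" by (simp add: e_def comp_assoc)
  finally have "t = n \<cdot> (a \<cdot> z)" by (rule flat_ext) simp_all
  then have "factors_through C t n" by (rule factors_throughI) simp_all
  then have "factors_through C (ide C (Cod C t)) n" by (intro strong_epi_extremal [OF t n]) simp_all
  then show "factors_through C (ide C (Cod C (f \<flat> g))) n" by simp
qed

section \<open>Cosmash products\<close>

lemma pair_comp_zero_iff:
  assumes [simp]: "f \<in> arr C" "g \<in> arr C" "Dom C f = Dom C g" "x \<in> arr C" "Cod C x = Dom C g"
  shows "pair C f g \<cdot> x = zero_arr C (Dom C x) (prd C (Cod C f) (Cod C g))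
    \<longleftrightarrow> f \<cdot> x = zero_arr C (Dom C x) (Cod C f) \<and> g \<cdot> x = zero_arr C (Dom C x) (Cod C g)"
proof -
  let ?z = "zero_arr C (Dom C x) (Dom C g)"
  have "pair C f g \<cdot> ?z = zero_arr C (Dom C x) (prd C (Cod C f) (Cod C g))" by simp
  then show ?thesis
    using pair_comp_eq_iff [of f g f g x ?z] by simp
qed

section \<open>Binary cosmash products\<close>

abbreviation coretract :: "'o \<Rightarrow> 'o \<Rightarrow> 'm" where
  "coretract A B \<equiv> copair C (zero_arr C A B) (ide C B)"

lemma hcosmash_arr [simp]:
  assumes "A \<in> obj C" "B \<in> obj C"
  shows "hcosmash C A B \<in> arr C" "Cod C (hcosmash C A B) = cop C A B"
  unfolding hcosmash_def using assms by simp_all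

lemma hcosmash_monic: "\<lbrakk>A \<in> obj C; B \<in> obj C\<rbrakk> \<Longrightarrow> monic C (hcosmash C A B)"
  unfolding hcosmash_def by (rule ker_monic) simp

lemma retract_hcosmash:
  assumes [simp]: "A \<in> obj C" "B \<in> obj C"
  shows "retract A B \<cdot> hcosmash C A B = zero_arr C (Dom C (hcosmash C A B)) A"
  using ker_arr(3) [of "pair C (retract A B) (coretract A B)", folded hcosmash_def]
    pair_comp_zero_iff [of "retract A B" "coretract A B" "hcosmash C A B"] by simp

lemma hcosmash_factors:
  assumes [simp]: "A \<in> obj C" "B \<in> obj C" "x \<in> arr C" "Cod C x = cop C A B"
    and "retract A B \<cdot> x = zero_arr C (Dom C x) A" "coretract A B \<cdot> x = zero_arr C (Dom C x) B"
  shows "factors_through C x (hcosmash C A B)"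
  unfolding hcosmash_def
  by (rule ker_factors) (use assms(5,6) pair_comp_zero_iff [of "retract A B" "coretract A B" x] in simp_all)

lemma cosmash_incl_eq [simp]:
  assumes [simp]: "A \<in> obj C" "B \<in> obj C"
  shows "cosmash_incl C A B \<in> arr C" "Dom C (cosmash_incl C A B) = Dom C (hcosmash C A B)"
    "Cod C (cosmash_incl C A B) = flat_obj C A B"
    "kflat C A B \<cdot> cosmash_incl C A B = hcosmash C A B"
proof -
  have "factors_through C (hcosmash C A B) (kflat C A B)"
    by (rule kflat_factors) (simp_all add: retract_hcosmash)
  from factor_eq [OF kflat_monic [OF assms] this, folded cosmash_incl_def]
  show "cosmash_incl C A B \<in> arr C" "Dom C (cosmash_incl C A B) = Dom C (hcosmash C A B)"
    "Cod C (cosmash_incl C A B) = flat_obj C A B"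
    "kflat C A B \<cdot> cosmash_incl C A B = hcosmash C A B"
    by simp_all
qed

section \<open>Ternary cosmash products and the folding morphisms\<close>

abbreviation drop1 :: "'o \<Rightarrow> 'o \<Rightarrow> 'o \<Rightarrow> 'm" where
  "drop1 A B D \<equiv> copair C (copair C (zero_arr C A (cop C B D)) (inl C B D)) (inr C B D)"

abbreviation drop2 :: "'o \<Rightarrow> 'o \<Rightarrow> 'o \<Rightarrow> 'm" where
  "drop2 A B D \<equiv> copair C (copair C (inl C A D) (zero_arr C B (cop C A D))) (inr C A D)"

text \<open>In the component forgetting \<open>D\<close> the inner copair of inclusions is an
  identity, so this component is the retraction whose kernel is \<open>(A + B) \<flat> D\<close>.
  Hence the ternary cosmash product lies in \<open>(A + B) \<flat> D\<close>.\<close>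

lemma hcosmash3_eq:
  assumes "A \<in> obj C" "B \<in> obj C" "D \<in> obj C"
  shows "hcosmash3 C A B D
    = ker C (pair C (pair C (retract (cop C A B) D) (drop2 A B D)) (drop1 A B D))"
  unfolding hcosmash3_def using assms by simp

lemma hcosmash3_arr [simp]:
  assumes "A \<in> obj C" "B \<in> obj C" "D \<in> obj C"
  shows "hcosmash3 C A B D \<in> arr C" "Cod C (hcosmash3 C A B D) = cop C (cop C A B) D"
  unfolding hcosmash3_eq [OF assms] using assms by simp_all

lemma drops_comp_zero_iff:
  assumes [simp]: "A \<in> obj C" "B \<in> obj C" "D \<in> obj C" "x \<in> arr C" "Cod C x = cop C (cop C A B) D"
  defines "E \<equiv> prd C (prd C (cop C A B) (cop C A D)) (cop C B D)"
  shows "pair C (pair C (retract (cop C A B) D) (drop2 A B D)) (drop1 A B D) \<cdot> x = zero_arr C (Dom C x) E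
    \<longleftrightarrow> retract (cop C A B) D \<cdot> x = zero_arr C (Dom C x) (cop C A B)
      \<and> drop2 A B D \<cdot> x = zero_arr C (Dom C x) (cop C A D)
      \<and> drop1 A B D \<cdot> x = zero_arr C (Dom C x) (cop C B D)"
  using pair_comp_zero_iff [of "pair C (retract (cop C A B) D) (drop2 A B D)" "drop1 A B D" x]
    pair_comp_zero_iff [of "retract (cop C A B) D" "drop2 A B D" x]
  unfolding E_def by simp

lemma hcosmash3_zero:
  assumes [simp]: "A \<in> obj C" "B \<in> obj C" "D \<in> obj C"
  shows "retract (cop C A B) D \<cdot> hcosmash3 C A B D = zero_arr C (Dom C (hcosmash3 C A B D)) (cop C A B)"
    "drop2 A B D \<cdot> hcosmash3 C A B D = zero_arr C (Dom C (hcosmash3 C A B D)) (cop C A D)"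
    "drop1 A B D \<cdot> hcosmash3 C A B D = zero_arr C (Dom C (hcosmash3 C A B D)) (cop C B D)"
  using ker_arr(3) [of "pair C (pair C (retract (cop C A B) D) (drop2 A B D)) (drop1 A B D)",
      folded hcosmash3_eq [OF assms]]
    drops_comp_zero_iff [of A B D "hcosmash3 C A B D"] by simp_all

lemma hcosmash3_factors:
  assumes [simp]: "A \<in> obj C" "B \<in> obj C" "D \<in> obj C" "x \<in> arr C" "Cod C x = cop C (cop C A B) D"
    and "retract (cop C A B) D \<cdot> x = zero_arr C (Dom C x) (cop C A B)"
    and "drop2 A B D \<cdot> x = zero_arr C (Dom C x) (cop C A D)"
    and "drop1 A B D \<cdot> x = zero_arr C (Dom C x) (cop C B D)"
  shows "factors_through C x (hcosmash3 C A B D)"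
  unfolding hcosmash3_eq [OF assms(1-3)]
  by (rule ker_factors) (use assms(6-8) drops_comp_zero_iff [of A B D x] in simp_all)

lemma jcosmash3_eq [simp]:
  assumes [simp]: "A \<in> obj C" "B \<in> obj C" "D \<in> obj C"
  shows "jcosmash3 C A B D \<in> arr C" "Dom C (jcosmash3 C A B D) = Dom C (hcosmash3 C A B D)"
    "Cod C (jcosmash3 C A B D) = flat_obj C (cop C A B) D"
    "kflat C (cop C A B) D \<cdot> jcosmash3 C A B D = hcosmash3 C A B D"
proof -
  have "factors_through C (hcosmash3 C A B D) (kflat C (cop C A B) D)"
    by (rule kflat_factors) (simp_all add: hcosmash3_zero)
  from factor_eq [OF kflat_monic this, folded jcosmash3_def]
  show "jcosmash3 C A B D \<in> arr C" "Dom C (jcosmash3 C A B D) = Dom C (hcosmash3 C A B D)"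
    "Cod C (jcosmash3 C A B D) = flat_obj C (cop C A B) D"
    "kflat C (cop C A B) D \<cdot> jcosmash3 C A B D = hcosmash3 C A B D"
    by simp_all
qed

text \<open>Each projection of the folded sum passes through one of the three components defining
  the ternary cosmash product: the projection to \<open>N\<close> already forgets the last
  \<open>M\<close>, and the projection to \<open>M\<close> forgets \<open>N\<close> before folding
  the two copies of \<open>M\<close>.\<close>

lemma fold_outer_eq [simp]:
  assumes [simp]: "N \<in> obj C" "M \<in> obj C"
  shows "fold_outer C N M \<in> arr C" "Dom C (fold_outer C N M) = Dom C (hcosmash3 C M N M)"
    "Cod C (fold_outer C N M) = Dom C (hcosmash C N M)"
    "hcosmash C N M \<cdot> fold_outer C N M
      = copair C (copair C (inr C N M) (inl C N M)) (inr C N M) \<cdot> hcosmash3 C M N M"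
proof -
  let ?fold = "copair C (copair C (inr C N M) (inl C N M)) (inr C N M)" and ?h = "hcosmash3 C M N M"
  have "factors_through C (?fold \<cdot> ?h) (hcosmash C N M)"
  proof (rule hcosmash_factors)
    have "retract N M \<cdot> ?fold = coretract M N \<cdot> retract (cop C M N) M"
      by (simp add: comp_copair)
    then have "retract N M \<cdot> (?fold \<cdot> ?h) = coretract M N \<cdot> (retract (cop C M N) M \<cdot> ?h)"
      by (rule comp_eq_reassoc) simp_all
    then show "retract N M \<cdot> (?fold \<cdot> ?h) = zero_arr C (Dom C (?fold \<cdot> ?h)) N"
      by (simp add: hcosmash3_zero)
    have "coretract N M \<cdot> ?fold = copair C (ide C M) (ide C M) \<cdot> drop2 M N M"
      by (simp add: comp_copair)
    then have "coretract N M \<cdot> (?fold \<cdot> ?h) = copair C (ide C M) (ide C M) \<cdot> (drop2 M N M \<cdot> ?h)"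
      by (rule comp_eq_reassoc) simp_all
    then show "coretract N M \<cdot> (?fold \<cdot> ?h) = zero_arr C (Dom C (?fold \<cdot> ?h)) M"
      by (simp add: hcosmash3_zero)
  qed simp_all
  from factor_eq [OF hcosmash_monic this, folded fold_outer_def]
  show "fold_outer C N M \<in> arr C" "Dom C (fold_outer C N M) = Dom C (hcosmash3 C M N M)"
    "Cod C (fold_outer C N M) = Dom C (hcosmash C N M)"
    "hcosmash C N M \<cdot> fold_outer C N M = ?fold \<cdot> hcosmash3 C M N M"
    by simp_all
qed

text \<open>As for \<open>fold_outer\<close>, except that the projection which folds two copies, now
  the one to \<open>N\<close>, passes through the component forgetting the first summand.\<close>

lemma fold_right_eq [simp]:
  assumes [simp]: "M \<in> obj C" "N \<in> obj C"
  shows "fold_right C M N \<in> arr C" "Dom C (fold_right C M N) = Dom C (hcosmash3 C M N N)"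
    "Cod C (fold_right C M N) = Dom C (hcosmash C M N)"
    "hcosmash C M N \<cdot> fold_right C M N
      = copair C (copair C (inl C M N) (inr C M N)) (inr C M N) \<cdot> hcosmash3 C M N N"
proof -
  let ?fold = "copair C (copair C (inl C M N) (inr C M N)) (inr C M N)" and ?h = "hcosmash3 C M N N"
  have "factors_through C (?fold \<cdot> ?h) (hcosmash C M N)"
  proof (rule hcosmash_factors)
    have "retract M N \<cdot> ?fold = retract M N \<cdot> retract (cop C M N) N"
      by (simp add: comp_copair)
    then have "retract M N \<cdot> (?fold \<cdot> ?h) = retract M N \<cdot> (retract (cop C M N) N \<cdot> ?h)"
      by (rule comp_eq_reassoc) simp_all
    then show "retract M N \<cdot> (?fold \<cdot> ?h) = zero_arr C (Dom C (?fold \<cdot> ?h)) M"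
      by (simp add: hcosmash3_zero)
    have "coretract M N \<cdot> ?fold = copair C (ide C N) (ide C N) \<cdot> drop1 M N N"
      by (simp add: comp_copair)
    then have "coretract M N \<cdot> (?fold \<cdot> ?h) = copair C (ide C N) (ide C N) \<cdot> (drop1 M N N \<cdot> ?h)"
      by (rule comp_eq_reassoc) simp_all
    then show "coretract M N \<cdot> (?fold \<cdot> ?h) = zero_arr C (Dom C (?fold \<cdot> ?h)) N"
      by (simp add: hcosmash3_zero)
  qed simp_all
  from factor_eq [OF hcosmash_monic this, folded fold_right_def]
  show "fold_right C M N \<in> arr C" "Dom C (fold_right C M N) = Dom C (hcosmash3 C M N N)"
    "Cod C (fold_right C M N) = Dom C (hcosmash C M N)"
    "hcosmash C M N \<cdot> fold_right C M N = ?fold \<cdot> hcosmash3 C M N N"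
    by simp_all
qed

text \<open>Protomodularity is used twice: for the split epimorphism \<open>(A + B) \<flat> D \<rightarrow> A \<flat> D\<close>, and
  for the split epimorphism from its kernel onto the kernel of \<open>B \<flat> D \<rightarrow> D\<close>. What is left is
  the ternary cosmash product.\<close>

lemma flat_cop_extremal:
  assumes [simp]: "A \<in> obj C" "B \<in> obj C" "D \<in> obj C"
    and e: "monic C e" and ec: "Cod C e = flat_obj C (cop C A B) D"
    and fl: "factors_through C (inl C A B \<flat> ide C D) e"
    and fr: "factors_through C (inr C A B \<flat> ide C D) e"
    and fj: "factors_through C (jcosmash3 C A B D) e"
  shows "factors_through C (ide C (flat_obj C (cop C A B) D)) e"
proof -
  note [simp] = monic_arr [OF e] ec
  let ?S = "cop C A B"
  let ?il = "inl C A B \<flat> ide C D" and ?ir = "inr C A B \<flat> ide C D"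
    and ?pl = "retract A B \<flat> ide C D" and ?pr = "coretract A B \<flat> ide C D"
  \<comment> \<open>\<open>\<tau> X\<close> takes the component in \<open>D\<close> of an element of
    \<open>X \<flat> D\<close>; its kernel is the binary cosmash product of \<open>X\<close> and
    \<open>D\<close>.\<close>
  define \<tau> where "\<tau> X = coretract X D \<cdot> kflat C X D" for X
  have \<tau> [simp]: "\<tau> X \<in> arr C" "Dom C (\<tau> X) = flat_obj C X D" "Cod C (\<tau> X) = D" if "X \<in> obj C" for X
    using that by (simp_all add: \<tau>_def)
  have \<tau>_nat: "\<tau> (Cod C f) \<cdot> (f \<flat> ide C D) = \<tau> (Dom C f)" if [simp]: "f \<in> arr C" for f
  proof -
    have "coretract (Cod C f) D \<cdot> (f \<oplus> ide C D) = coretract (Dom C f) D"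
      by (simp add: copair_cop_map)
    then have "coretract (Cod C f) D \<cdot> ((f \<oplus> ide C D) \<cdot> kflat C (Dom C f) D) = \<tau> (Dom C f)"
      unfolding \<tau>_def by (rule comp_eq_reassoc1) simp_all
    then show ?thesis unfolding \<tau>_def by (simp add: comp_assoc kflat_flat_map)
  qed
  define \<delta> where "\<delta> = ker C (\<tau> B)"
  have [simp]: "\<delta> \<in> arr C" "Cod C \<delta> = flat_obj C B D" by (simp_all add: \<delta>_def)
  have \<tau>\<delta>: "\<tau> B \<cdot> \<delta> = zero_arr C (Dom C \<delta>) D"
    using ker_arr(3) [of "\<tau> B", folded \<delta>_def] by simp
  define \<kappa> where "\<kappa> = ker C ?pl"
  have [simp]: "\<kappa> \<in> arr C" "Cod C \<kappa> = flat_obj C ?S D" by (simp_all add: \<kappa>_def)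
  have pl\<kappa>: "?pl \<cdot> \<kappa> = zero_arr C (Dom C \<kappa>) (flat_obj C A D)"
    using ker_arr(3) [of ?pl, folded \<kappa>_def] by simp
  have "?pl \<cdot> ?il = ide C (flat_obj C A D)" by (simp add: flat_map_comp)
  then have pt1: "is_point C (flat_obj C A D) (flat_obj C ?S D) ?pl ?il"
    unfolding is_point_def by (simp add: hom_def)
  \<comment> \<open>By naturality of \<open>\<tau>\<close> the component in \<open>D\<close> is the
    same whether \<open>A\<close> or \<open>B\<close> is forgotten, and on \<open>\<kappa>\<close>
    it vanishes because \<open>?pl\<close> does.\<close>
  have "\<tau> B \<cdot> (?pr \<cdot> \<kappa>) = \<tau> A \<cdot> (?pl \<cdot> \<kappa>)"
    using \<tau>_nat [of "coretract A B"] \<tau>_nat [of "retract A B"] by (intro comp_eq_reassoc) simp_all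
  then have "factors_through C (?pr \<cdot> \<kappa>) \<delta>"
    unfolding \<delta>_def by (intro ker_factors) (simp_all add: pl\<kappa>)
  from factors_throughD [OF this, of "Dom C \<kappa>"]
  obtain \<rho> where [simp]: "\<rho> \<in> arr C" "Dom C \<rho> = Dom C \<kappa>" "Cod C \<rho> = Dom C \<delta>" and \<rho>: "?pr \<cdot> \<kappa> = \<delta> \<cdot> \<rho>"
    by auto
  \<comment> \<open>When \<open>B\<close> is forgotten, an element coming from
    \<open>B \<flat> D\<close> retains only its component in \<open>D\<close>, which is zero on
    \<open>\<delta>\<close>.\<close>
  have "kflat C A D \<cdot> ((?pl \<cdot> ?ir) \<cdot> \<delta>) = inr C A D \<cdot> (\<tau> B \<cdot> \<delta>)"
    by (simp add: flat_map_comp kflat_flat_map_comp \<tau>_def cop_map_def comp_assoc comp_copair)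
      (simp add: comp_assoc [symmetric] comp_copair)
  also have "\<dots> = kflat C A D \<cdot> zero_arr C (Dom C \<delta>) (flat_obj C A D)" by (simp add: \<tau>\<delta>)
  finally have "(?pl \<cdot> ?ir) \<cdot> \<delta> = zero_arr C (Dom C \<delta>) (flat_obj C A D)"
    by (rule flat_ext) simp_all
  then have "factors_through C (?ir \<cdot> \<delta>) \<kappa>"
    unfolding \<kappa>_def by (intro ker_factors) (simp_all add: comp_assoc)
  from factors_throughD [OF this, of "Dom C \<delta>"]
  obtain \<sigma> where [simp]: "\<sigma> \<in> arr C" "Dom C \<sigma> = Dom C \<delta>" "Cod C \<sigma> = Dom C \<kappa>" and \<sigma>: "?ir \<cdot> \<delta> = \<kappa> \<cdot> \<sigma>"
    by auto
  have "\<delta> \<cdot> (\<rho> \<cdot> \<sigma>) = ?pr \<cdot> (\<kappa> \<cdot> \<sigma>)" by (rule comp_eq_reassoc [OF \<rho> [symmetric]]) simp_all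
  also have "\<dots> = (?pr \<cdot> ?ir) \<cdot> \<delta>" by (simp add: \<sigma> [symmetric] comp_assoc)
  also have "\<dots> = \<delta> \<cdot> ide C (Dom C \<delta>)" by (simp add: flat_map_comp)
  finally have "\<rho> \<cdot> \<sigma> = ide C (Dom C \<delta>)"
    by (rule monicD [OF ker_monic [of "\<tau> B", folded \<delta>_def], rotated]) simp_all
  then have pt2: "is_point C (Dom C \<delta>) (Dom C \<kappa>) \<rho> \<sigma>"
    unfolding is_point_def by (simp add: hom_def)
  \<comment> \<open>\<open>y\<close> is the generic element of \<open>(A + B) \<flat> D\<close>
    killed by forgetting \<open>B\<close> and by forgetting \<open>A\<close>. Forgetting
    \<open>D\<close> kills all of \<open>(A + B) \<flat> D\<close>, so \<open>y\<close> comes from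
    the ternary cosmash product.\<close>
  define y where "y = \<kappa> \<cdot> ker C \<rho>"
  have [simp]: "y \<in> arr C" "Dom C y = Dom C (ker C \<rho>)" "Cod C y = flat_obj C ?S D" by (simp_all add: y_def)
  have ply: "?pl \<cdot> y = zero_arr C (Dom C y) (flat_obj C A D)"
    unfolding y_def using comp_eq_reassoc1 [OF pl\<kappa>, of "ker C \<rho>"] by simp
  have pry: "?pr \<cdot> y = zero_arr C (Dom C y) (flat_obj C B D)"
    unfolding y_def using comp_eq_reassoc [OF \<rho>, of "ker C \<rho>"] by simp
  have "factors_through C (kflat C ?S D \<cdot> y) (hcosmash3 C A B D)"
  proof (rule hcosmash3_factors)
    show "retract ?S D \<cdot> (kflat C ?S D \<cdot> y) = zero_arr C (Dom C (kflat C ?S D \<cdot> y)) ?S"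
      using comp_eq_reassoc1 [OF retract_kflat, of ?S D y] by simp
    have "drop2 A B D = retract A B \<oplus> ide C D" by (simp add: cop_map_def comp_copair)
    then show "drop2 A B D \<cdot> (kflat C ?S D \<cdot> y) = zero_arr C (Dom C (kflat C ?S D \<cdot> y)) (cop C A D)"
      using kflat_flat_map_comp [of "retract A B" "ide C D" A D y] by (simp add: ply)
    have "drop1 A B D = coretract A B \<oplus> ide C D" by (simp add: cop_map_def comp_copair)
    then show "drop1 A B D \<cdot> (kflat C ?S D \<cdot> y) = zero_arr C (Dom C (kflat C ?S D \<cdot> y)) (cop C B D)"
      using kflat_flat_map_comp [of "coretract A B" "ide C D" B D y] by (simp add: pry)
  qed simp_all
  from factors_throughD [OF this, of "Dom C y"]
  obtain z where [simp]: "z \<in> arr C" "Dom C z = Dom C y" "Cod C z = Dom C (hcosmash3 C A B D)"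
    and z: "kflat C ?S D \<cdot> y = hcosmash3 C A B D \<cdot> z"
    by auto
  have "kflat C ?S D \<cdot> y = kflat C ?S D \<cdot> (jcosmash3 C A B D \<cdot> z)"
    unfolding z by (rule comp_eq_reassoc1 [OF jcosmash3_eq(4), symmetric]) simp_all
  then have y: "y = jcosmash3 C A B D \<cdot> z" by (rule flat_ext) simp_all
  have \<kappa>e: "factors_through C \<kappa> e"
  proof (rule point_factors_through [OF pt2 e])
    show "factors_through C (\<kappa> \<cdot> \<sigma>) e"
      unfolding \<sigma> [symmetric] by (rule factors_through_comp [OF fr]) simp_all
    show "factors_through C (\<kappa> \<cdot> ker C \<rho>) e"
      unfolding y_def [symmetric] y by (rule factors_through_comp [OF fj]) simp_all
  qed simp_all
  show ?thesis
    by (rule point_factors_through [OF pt1 e]) (simp_all add: fl \<kappa>e \<kappa>_def [symmetric])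
qed

text \<open>Extremality is applied to the equaliser of \<open>f\<close> and \<open>g\<close>,
  through which the three pieces factor.\<close>

lemma flat_cop_ext:
  assumes [simp]: "A \<in> obj C" "B \<in> obj C" "D \<in> obj C" "f \<in> arr C" "g \<in> arr C"
    and [simp]: "Dom C f = flat_obj C (cop C A B) D" "Dom C g = flat_obj C (cop C A B) D"
    and [simp]: "Cod C f = T" "Cod C g = T"
    and "f \<cdot> (inl C A B \<flat> ide C D) = g \<cdot> (inl C A B \<flat> ide C D)"
    and "f \<cdot> (inr C A B \<flat> ide C D) = g \<cdot> (inr C A B \<flat> ide C D)"
    and "f \<cdot> jcosmash3 C A B D = g \<cdot> jcosmash3 C A B D"
  shows "f = g"
proof -
  obtain e where e: "monic C e" "Cod C e = Dom C f" "f \<cdot> e = g \<cdot> e"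
    and univ: "\<And>x. \<lbrakk>x \<in> arr C; Cod C x = Dom C f; f \<cdot> x = g \<cdot> x\<rbrakk> \<Longrightarrow> factors_through C x e"
    by (rule equalizer_exists [of f g]) simp_all
  note [simp] = monic_arr [OF e(1)] e(2)
  have "factors_through C (ide C (flat_obj C (cop C A B) D)) e"
    by (rule flat_cop_extremal [OF assms(1-3) e(1)]) (use assms(10-12) in \<open>simp_all add: univ\<close>)
  then obtain d where d: "d \<in> arr C" "Cod C d = Dom C e" "ide C (flat_obj C (cop C A B) D) = e \<cdot> d"
    by (rule factors_throughE)
  have "f \<cdot> (e \<cdot> d) = g \<cdot> (e \<cdot> d)"
    by (rule comp_eq_reassoc [OF e(3)]) (use d(1,2) in simp_all)
  then show ?thesis by (simp add: d(3) [symmetric])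
qed

section \<open>Descent of actions to the Peiffer product\<close>

lemma internal_actionD:
  assumes "internal_action C A X \<xi>"
  shows "A \<in> obj C" "X \<in> obj C" "\<xi> \<in> arr C" "Dom C \<xi> = flat_obj C A X" "Cod C \<xi> = X"
    "\<xi> \<cdot> flat_unit C A X = ide C X" "\<xi> \<cdot> flat_mult C A X = \<xi> \<cdot> (ide C A \<flat> \<xi>)"
  using assms unfolding internal_action_def by (auto simp: hom_def)

text \<open>Only the acting object changes. The unit law transfers at once, since
  \<open>q \<flat> ide C X\<close> carries one unit to the other. The two sides of associativity
  agree after \<open>q \<flat> (q \<flat> ide C X)\<close>, by naturality of the multiplication, and
  this strong epimorphism is cancelled.\<close>

lemma internal_action_quotient:
  assumes act: "internal_action C A X \<xi>A" and q: "strong_epi C q" and [simp]: "Dom C q = A"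
    and \<xi>: "\<xi> \<in> hom C (flat_obj C (Cod C q) X) X" and eq: "\<xi> \<cdot> (q \<flat> ide C X) = \<xi>A"
  shows "internal_action C (Cod C q) X \<xi>"
proof -
  note [simp] = internal_actionD(1-5) [OF act] strong_epi_arr [OF q] in_homE [OF \<xi>]
  let ?Q = "Cod C q" and ?q1 = "q \<flat> ide C X"
  have "\<xi> \<cdot> (flat_unit C ?Q X \<cdot> ide C X) = \<xi> \<cdot> (?q1 \<cdot> flat_unit C A X)"
    using flat_unit_natural [of q "ide C X"] by simp
  also have "\<dots> = ide C X"
    using comp_eq_reassoc1 [OF eq, of "flat_unit C A X"] internal_actionD(6) [OF act] by simp
  finally have unit: "\<xi> \<cdot> flat_unit C ?Q X = ide C X" by simp
  have "\<xi> \<cdot> (flat_mult C ?Q X \<cdot> (q \<flat> ?q1)) = \<xi> \<cdot> (?q1 \<cdot> flat_mult C A X)"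
    using flat_mult_natural [of q "ide C X"] by simp
  also have "\<dots> = \<xi>A \<cdot> flat_mult C A X" by (rule comp_eq_reassoc1 [OF eq]) simp_all
  also have "\<dots> = \<xi>A \<cdot> (ide C A \<flat> \<xi>A)" by (rule internal_actionD(7) [OF act])
  also have "\<dots> = \<xi> \<cdot> (?q1 \<cdot> (ide C A \<flat> \<xi>A))" by (rule comp_eq_reassoc1 [OF eq, symmetric]) simp_all
  also have "?q1 \<cdot> (ide C A \<flat> \<xi>A) = (ide C ?Q \<flat> \<xi>) \<cdot> (q \<flat> ?q1)"
    by (simp add: flat_map_comp eq)
  finally have eq1: "(\<xi> \<cdot> flat_mult C ?Q X) \<cdot> (q \<flat> ?q1) = (\<xi> \<cdot> (ide C ?Q \<flat> \<xi>)) \<cdot> (q \<flat> ?q1)"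
    by (simp add: comp_assoc)
  have "strong_epi C (q \<flat> ?q1)"
    by (intro flat_map_strong_epi q strong_epi_ide) simp
  then have "\<xi> \<cdot> flat_mult C ?Q X = \<xi> \<cdot> (ide C ?Q \<flat> \<xi>)"
    by (rule strong_epi_epi [OF _ _ _ _ _ eq1]) simp_all
  then show ?thesis unfolding internal_action_def using \<xi> unit by simp
qed

text \<open>The right-hand side of \<open>pre\<close> is the conjugation action of the quotient
  composed with \<open>q \<flat> (q \<cdot> i)\<close>, so \<open>pre\<close> is the precrossed
  identity precomposed with the strong epimorphism \<open>q \<flat> ide C X\<close>. The Peiffer
  identity follows directly, because \<open>(q \<cdot> i) \<flat> ide C X\<close> factors through
  that same arrow.\<close>

lemma internal_crossed_module_quotient:
  assumes act: "internal_action C A X \<xi>A" and q: "strong_epi C q" and [simp]: "Dom C q = A"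
    and \<xi>: "\<xi> \<in> hom C (flat_obj C (Cod C q) X) X" and eq: "\<xi> \<cdot> (q \<flat> ide C X) = \<xi>A"
    and [simp]: "i \<in> arr C" "Dom C i = X" "Cod C i = A"
    and peiffer: "\<xi>A \<cdot> (i \<flat> ide C X) = conj_action C X"
    and pre: "(q \<cdot> i) \<cdot> \<xi>A = copair C q (q \<cdot> i) \<cdot> kflat C A X"
  shows "internal_crossed_module C X (Cod C q) (q \<cdot> i) \<xi>"
proof -
  note [simp] = internal_actionD(1-5) [OF act] strong_epi_arr [OF q] in_homE [OF \<xi>]
  let ?Q = "Cod C q" and ?q1 = "q \<flat> ide C X" and ?d = "q \<cdot> i"
  have "\<xi> \<cdot> (?d \<flat> ide C X) = \<xi> \<cdot> (?q1 \<cdot> (i \<flat> ide C X))" by (simp add: flat_map_comp)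
  also have "\<dots> = \<xi>A \<cdot> (i \<flat> ide C X)" by (rule comp_eq_reassoc1 [OF eq]) simp_all
  finally have 1: "\<xi> \<cdot> (?d \<flat> ide C X) = conj_action C X" using peiffer by simp
  have conj [simp]: "conj_action C ?Q \<in> arr C" "Dom C (conj_action C ?Q) = flat_obj C ?Q ?Q"
    "Cod C (conj_action C ?Q) = ?Q"
    unfolding conj_action_def by simp_all
  have "(?d \<cdot> \<xi>) \<cdot> ?q1 = ?d \<cdot> \<xi>A" using comp_assoc [of ?q1 \<xi> ?d] eq by simp
  also have "\<dots> = copair C q ?d \<cdot> kflat C A X" by (rule pre)
  also have "\<dots> = (copair C (ide C ?Q) (ide C ?Q) \<cdot> (q \<oplus> ?d)) \<cdot> kflat C A X"
    by (simp add: copair_cop_map)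
  also have "\<dots> = copair C (ide C ?Q) (ide C ?Q) \<cdot> (kflat C ?Q ?Q \<cdot> (q \<flat> ?d))"
    by (simp add: comp_assoc kflat_flat_map)
  also have "\<dots> = conj_action C ?Q \<cdot> ((ide C ?Q \<flat> ?d) \<cdot> ?q1)"
    unfolding conj_action_def by (simp add: comp_assoc flat_map_comp)
  also have "\<dots> = (conj_action C ?Q \<cdot> (ide C ?Q \<flat> ?d)) \<cdot> ?q1"
    by (rule comp_assoc [symmetric]) simp_all
  finally have "?d \<cdot> \<xi> = conj_action C ?Q \<cdot> (ide C ?Q \<flat> ?d)"
    by (rule strong_epi_epi [OF flat_map_strong_epi [OF q strong_epi_ide], rotated 5]) simp_all
  then show ?thesis
    unfolding internal_crossed_module_def
    using 1 internal_action_quotient [OF act q _ \<xi> eq] by (simp add: hom_def)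
qed

text \<open>Restricted to the two summands, the coequaliser equation says that conjugation in the
  quotient realises the given actions. In the first identity \<open>swap\<close> reverses the order
  of the two composites with the inclusions; in the second their copair is \<open>q\<close>
  itself.\<close>

lemma peiffer_identities:
  assumes "internal_action C M N \<xi>MN" "internal_action C N M \<xi>NM"
    and pp: "is_peiffer_product C M N \<xi>MN \<xi>NM q"
  shows "q \<in> arr C" "Dom C q = cop C M N"
    "copair C (q \<cdot> inr C M N) (q \<cdot> inl C M N) \<cdot> kflat C N M = (q \<cdot> inl C M N) \<cdot> \<xi>NM"
    "q \<cdot> kflat C M N = (q \<cdot> inr C M N) \<cdot> \<xi>MN"
proof -
  note [simp] = internal_actionD(1-5) [OF assms(1)] internal_actionD(1-5) [OF assms(2)]
  have pk: "Cod C (peiffer_k C M N) = cop C M N" "peiffer_k C M N \<in> arr C"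
    "Dom C (peiffer_k C M N) = cop C (flat_obj C N M) (flat_obj C M N)"
    unfolding peiffer_k_def swap_def by simp_all
  show [simp]: "q \<in> arr C" "Dom C q = cop C M N"
    using pp pk unfolding is_peiffer_product_def is_coequalizer_def by simp_all
  have eq: "q \<cdot> peiffer_k C M N = q \<cdot> peiffer_xi C \<xi>MN \<xi>NM"
    using pp unfolding is_peiffer_product_def is_coequalizer_def by blast
  have px: "peiffer_xi C \<xi>MN \<xi>NM \<in> arr C" "Cod C (peiffer_xi C \<xi>MN \<xi>NM) = cop C M N"
    "Dom C (peiffer_xi C \<xi>MN \<xi>NM) = cop C (flat_obj C N M) (flat_obj C M N)"
    unfolding peiffer_xi_def by simp_all
  have "q \<cdot> (peiffer_k C M N \<cdot> inl C (flat_obj C N M) (flat_obj C M N))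
      = q \<cdot> (peiffer_xi C \<xi>MN \<xi>NM \<cdot> inl C (flat_obj C N M) (flat_obj C M N))"
    by (rule comp_eq_reassoc [OF eq]) (simp_all add: pk px)
  then have "q \<cdot> (swap C N M \<cdot> kflat C N M) = q \<cdot> (inl C M N \<cdot> \<xi>NM)"
    unfolding peiffer_k_def peiffer_xi_def swap_def by (simp add: cop_map_inj)
  moreover have "q \<cdot> swap C N M = copair C (q \<cdot> inr C M N) (q \<cdot> inl C M N)"
    unfolding swap_def by (simp add: comp_copair)
  then have "q \<cdot> (swap C N M \<cdot> kflat C N M) = copair C (q \<cdot> inr C M N) (q \<cdot> inl C M N) \<cdot> kflat C N M"
    by (rule comp_eq_reassoc1) (simp_all add: swap_def)
  ultimately show "copair C (q \<cdot> inr C M N) (q \<cdot> inl C M N) \<cdot> kflat C N M = (q \<cdot> inl C M N) \<cdot> \<xi>NM"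
    by (simp add: comp_assoc)
  have "q \<cdot> (peiffer_k C M N \<cdot> inr C (flat_obj C N M) (flat_obj C M N))
      = q \<cdot> (peiffer_xi C \<xi>MN \<xi>NM \<cdot> inr C (flat_obj C N M) (flat_obj C M N))"
    by (rule comp_eq_reassoc [OF eq]) (simp_all add: pk px)
  then show "q \<cdot> kflat C M N = (q \<cdot> inr C M N) \<cdot> \<xi>MN"
    unfolding peiffer_k_def peiffer_xi_def swap_def by (simp add: cop_map_inj comp_assoc)
qed

text \<open>For the action on \<open>M\<close>: on the piece from \<open>M\<close> both sides are
  the conjugation of \<open>M\<close> followed by \<open>q \<cdot> inl C M N\<close>, and on the
  piece from \<open>N\<close> the identity is a Peiffer relation. On the cosmash product (CA.0)
  writes the action as folding followed by the given action, to which the same Peiffer relation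
  applies. The action on \<open>N\<close> is symmetric.\<close>

lemma peiffer_precrossed:
  assumes MN: "internal_action C M N \<xi>MN" and NM: "internal_action C N M \<xi>NM"
    and pp: "is_peiffer_product C M N \<xi>MN \<xi>NM q"
    and wit: "compatibility_witness C M N \<xi>MN \<xi>NM \<xi>M \<xi>N"
  shows "(q \<cdot> inl C M N) \<cdot> \<xi>M = copair C q (q \<cdot> inl C M N) \<cdot> kflat C (cop C M N) M"
    and "(q \<cdot> inr C M N) \<cdot> \<xi>N = copair C q (q \<cdot> inr C M N) \<cdot> kflat C (cop C M N) N"
proof -
  have actM: "internal_action C (cop C M N) M \<xi>M" and actN: "internal_action C (cop C M N) N \<xi>N"
    and MN_M: "\<xi>M \<cdot> (inr C M N \<flat> ide C M) = \<xi>NM"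
    and M_M: "\<xi>M \<cdot> (inl C M N \<flat> ide C M) = conj_action C M"
    and j_M: "\<xi>M \<cdot> jcosmash3 C M N M = \<xi>NM \<cdot> (cosmash_incl C N M \<cdot> fold_outer C N M)"
    and MN_N: "\<xi>N \<cdot> (inl C M N \<flat> ide C N) = \<xi>MN"
    and N_N: "\<xi>N \<cdot> (inr C M N \<flat> ide C N) = conj_action C N"
    and j_N: "\<xi>N \<cdot> jcosmash3 C M N N = \<xi>MN \<cdot> (cosmash_incl C M N \<cdot> fold_right C M N)"
    using wit unfolding compatibility_witness_def by simp_all
  note [simp] = internal_actionD(1-5) [OF MN] internal_actionD(1-5) [OF NM]
    internal_actionD(3-5) [OF actM] internal_actionD(3-5) [OF actN]
  note [simp] = peiffer_identities(1,2) [OF MN NM pp]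
  note kNM = peiffer_identities(3) [OF MN NM pp] and kMN = peiffer_identities(4) [OF MN NM pp]
  let ?S = "cop C M N" and ?lM = "q \<cdot> inl C M N" and ?lN = "q \<cdot> inr C M N"
  have q: "copair C ?lM ?lN = q"
    by (rule cop_ext [of M N]) simp_all
  \<comment> \<open>Restriction along \<open>f\<close> changes only the conjugating component, from
    \<open>q\<close> to \<open>q \<cdot> f\<close>.\<close>
  have restrict: "(copair C q l \<cdot> kflat C ?S X) \<cdot> (f \<flat> ide C X) = copair C (q \<cdot> f) l \<cdot> kflat C (Dom C f) X"
    if "f \<in> arr C" "Cod C f = ?S" "l \<in> arr C" "Dom C l = X" "Cod C l = Cod C q" for f l X
  proof -
    have X: "X \<in> obj C" using that Dom_in_obj [of l] by simp
    have "(copair C q l \<cdot> kflat C ?S X) \<cdot> (f \<flat> ide C X)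
        = copair C q l \<cdot> ((f \<oplus> ide C X) \<cdot> kflat C (Dom C f) X)"
      using that X by (simp add: comp_assoc kflat_flat_map)
    also have "\<dots> = copair C (q \<cdot> f) l \<cdot> kflat C (Dom C f) X"
      by (rule comp_eq_reassoc1) (use that X in \<open>simp_all add: copair_cop_map\<close>)
    finally show ?thesis .
  qed
  have conj: "l \<cdot> conj_action C X = copair C l l \<cdot> kflat C X X" if "l \<in> arr C" "Dom C l = X" for l X
  proof -
    have "X \<in> obj C" using that Dom_in_obj [of l] by simp
    then show ?thesis
      unfolding conj_action_def using that comp_copair [of "ide C X" "ide C X" l]
      by (intro comp_eq_reassoc1) simp_all
  qed
  have restrict_j: "(copair C q l \<cdot> kflat C ?S X) \<cdot> jcosmash3 C M N X = copair C q l \<cdot> hcosmash3 C M N X"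
    if "l \<in> arr C" "Dom C l = X" "Cod C l = Cod C q" for l X
    using that Dom_in_obj [of l] by (simp add: comp_assoc)
  show "?lM \<cdot> \<xi>M = copair C q ?lM \<cdot> kflat C ?S M"
  proof (rule flat_cop_ext [of M N M _ _ "Cod C q"])
    show "(?lM \<cdot> \<xi>M) \<cdot> (inl C M N \<flat> ide C M) = (copair C q ?lM \<cdot> kflat C ?S M) \<cdot> (inl C M N \<flat> ide C M)"
      using comp_assoc [of "inl C M N \<flat> ide C M" \<xi>M ?lM] by (simp add: restrict M_M conj)
    show "(?lM \<cdot> \<xi>M) \<cdot> (inr C M N \<flat> ide C M) = (copair C q ?lM \<cdot> kflat C ?S M) \<cdot> (inr C M N \<flat> ide C M)"
      using comp_assoc [of "inr C M N \<flat> ide C M" \<xi>M ?lM] by (simp add: restrict MN_M kNM)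
    let ?fold = "copair C (copair C (inr C N M) (inl C N M)) (inr C N M)"
    have "(?lM \<cdot> \<xi>M) \<cdot> jcosmash3 C M N M = ?lM \<cdot> (\<xi>NM \<cdot> (cosmash_incl C N M \<cdot> fold_outer C N M))"
      using comp_assoc [of "jcosmash3 C M N M" \<xi>M ?lM] j_M by simp
    also have "\<dots> = copair C ?lN ?lM \<cdot> (kflat C N M \<cdot> (cosmash_incl C N M \<cdot> fold_outer C N M))"
      by (rule comp_eq_reassoc [OF kNM [symmetric]]) simp_all
    also have "\<dots> = copair C ?lN ?lM \<cdot> (?fold \<cdot> hcosmash3 C M N M)"
      using comp_eq_reassoc1 [OF cosmash_incl_eq(4), of N M "fold_outer C N M"] by simp
    \<comment> \<open>Since \<open>q\<close> itself restricts to \<open>?lM\<close> on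
      \<open>M\<close>, the arrow \<open>copair C q ?lM\<close> treats the two copies of
      \<open>M\<close> alike and so factors through the folding.\<close>
    also have "\<dots> = copair C q ?lM \<cdot> hcosmash3 C M N M"
      by (rule comp_eq_reassoc1) (simp_all add: comp_copair q)
    finally show "(?lM \<cdot> \<xi>M) \<cdot> jcosmash3 C M N M = (copair C q ?lM \<cdot> kflat C ?S M) \<cdot> jcosmash3 C M N M"
      by (simp add: restrict_j)
  qed simp_all
  show "?lN \<cdot> \<xi>N = copair C q ?lN \<cdot> kflat C ?S N"
  proof (rule flat_cop_ext [of M N N _ _ "Cod C q"])
    show "(?lN \<cdot> \<xi>N) \<cdot> (inl C M N \<flat> ide C N) = (copair C q ?lN \<cdot> kflat C ?S N) \<cdot> (inl C M N \<flat> ide C N)"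
      using comp_assoc [of "inl C M N \<flat> ide C N" \<xi>N ?lN] by (simp add: restrict MN_N kMN q)
    show "(?lN \<cdot> \<xi>N) \<cdot> (inr C M N \<flat> ide C N) = (copair C q ?lN \<cdot> kflat C ?S N) \<cdot> (inr C M N \<flat> ide C N)"
      using comp_assoc [of "inr C M N \<flat> ide C N" \<xi>N ?lN] by (simp add: restrict N_N conj)
    let ?fold = "copair C (copair C (inl C M N) (inr C M N)) (inr C M N)"
    have "(?lN \<cdot> \<xi>N) \<cdot> jcosmash3 C M N N = ?lN \<cdot> (\<xi>MN \<cdot> (cosmash_incl C M N \<cdot> fold_right C M N))"
      using comp_assoc [of "jcosmash3 C M N N" \<xi>N ?lN] j_N by simp
    also have "\<dots> = q \<cdot> (kflat C M N \<cdot> (cosmash_incl C M N \<cdot> fold_right C M N))"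
      by (rule comp_eq_reassoc [OF kMN [symmetric]]) simp_all
    \<comment> \<open>The inner copair of \<open>?fold\<close> is an identity; it is kept
      unevaluated so that \<open>?fold\<close> retains the form it has in
      \<open>fold_right_eq\<close>.\<close>
    also have "\<dots> = q \<cdot> (?fold \<cdot> hcosmash3 C M N N)"
      using comp_eq_reassoc1 [OF cosmash_incl_eq(4), of M N "fold_right C M N"] fold_right_eq(4) [of M N]
      by (simp del: copair_inl_inr)
    also have "\<dots> = copair C q ?lN \<cdot> hcosmash3 C M N N"
      by (rule comp_eq_reassoc1) (simp_all add: comp_copair)
    finally show "(?lN \<cdot> \<xi>N) \<cdot> jcosmash3 C M N N = (copair C q ?lN \<cdot> kflat C ?S N) \<cdot> jcosmash3 C M N N"
      by (simp add: restrict_j)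
  qed simp_all
qed

end

theorem proposition3p9:
  fixes C :: "('o, 'm, 'z) chosen_category_scheme" (structure)
    and M N Q :: 'o
    and \<xi>MN \<xi>NM \<xi>M \<xi>N q lM lN \<xi>QM \<xi>QN :: 'm
  assumes "chosen_semi_abelian_category C"
    and "smith_is_huq C"
    and "compatible_actions C M N \<xi>MN \<xi>NM"
    and "compatibility_witness C M N \<xi>MN \<xi>NM \<xi>M \<xi>N"
    and "is_peiffer_product C M N \<xi>MN \<xi>NM q"
    and "Q = Cod C q"
    and "lM = q \<cdot> inl C M N"
    and "lN = q \<cdot> inr C M N"
    and "\<xi>QM \<in> hom C (flat_obj C Q M) M" and "\<xi>QM \<cdot> (q \<flat> ide C M) = \<xi>M"
    and "\<xi>QN \<in> hom C (flat_obj C Q N) N" and "\<xi>QN \<cdot> (q \<flat> ide C N) = \<xi>N"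
  shows "(internal_action C Q M \<xi>QM \<and> internal_action C Q N \<xi>QN)
    \<and> (internal_crossed_module C M Q lM \<xi>QM \<and> internal_crossed_module C N Q lN \<xi>QN)
    \<and> (\<xi>QN \<cdot> (lM \<flat> ide C N) = \<xi>MN \<and> \<xi>QM \<cdot> (lN \<flat> ide C M) = \<xi>NM)"
proof -
  interpret chosen_semi_abelian_category C by (rule assms(1))
  have MN: "internal_action C M N \<xi>MN" and NM: "internal_action C N M \<xi>NM"
    using assms(3) unfolding compatible_actions_def by blast+
  note pp = assms(5) and wit = assms(4) [unfolded compatibility_witness_def]
  note [simp] = internal_actionD(1-5) [OF MN] internal_actionD(1-5) [OF NM]
    peiffer_identities(1,2) [OF MN NM pp]
  have q: "strong_epi C q"
    using pp unfolding is_peiffer_product_def by (rule coequalizer_strong_epi)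
  note QM = assms(9) [unfolded assms(6)] and QN = assms(11) [unfolded assms(6)]
  note [simp] = in_homE [OF QM] in_homE [OF QN]
  have actM: "internal_action C (cop C M N) M \<xi>M" and actN: "internal_action C (cop C M N) N \<xi>N"
    using wit by blast+
  have crM: "internal_crossed_module C M (Cod C q) (q \<cdot> inl C M N) \<xi>QM"
    by (rule internal_crossed_module_quotient [OF actM q _ QM assms(10)])
      (use wit peiffer_precrossed(1) [OF MN NM pp assms(4)] in simp_all)
  have crN: "internal_crossed_module C N (Cod C q) (q \<cdot> inr C M N) \<xi>QN"
    by (rule internal_crossed_module_quotient [OF actN q _ QN assms(12)])
      (use wit peiffer_precrossed(2) [OF MN NM pp assms(4)] in simp_all)
  \<comment> \<open>\<open>lM \<flat> ide C N\<close> is \<open>q \<flat> ide C N\<close> after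
    \<open>inl C M N \<flat> ide C N\<close>, so the induced action is the restriction of
    \<open>\<xi>N\<close> that (CA.0) prescribes.\<close>
  have "\<xi>QN \<cdot> ((q \<flat> ide C N) \<cdot> (inl C M N \<flat> ide C N)) = \<xi>N \<cdot> (inl C M N \<flat> ide C N)"
    by (rule comp_eq_reassoc1 [OF assms(12)]) simp_all
  then have indN: "\<xi>QN \<cdot> ((q \<cdot> inl C M N) \<flat> ide C N) = \<xi>MN"
    using wit by (simp add: flat_map_comp)
  have "\<xi>QM \<cdot> ((q \<flat> ide C M) \<cdot> (inr C M N \<flat> ide C M)) = \<xi>M \<cdot> (inr C M N \<flat> ide C M)"
    by (rule comp_eq_reassoc1 [OF assms(10)]) simp_all
  then have indM: "\<xi>QM \<cdot> ((q \<cdot> inr C M N) \<flat> ide C M) = \<xi>NM"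
    using wit by (simp add: flat_map_comp)
  show ?thesis
    unfolding assms(6-8) using crM crN indM indN
    by (simp add: internal_crossed_module_def)
qed

end
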